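(* Let $\lambda_2>0$, $0<r<R_L$, $d>0$, $\lambda>0$, $\alpha_2\ge 2$, $s>0$, and let $N_2\ge 1$, $N_2^p\ge 1$, $n\ge 1$ be integers. Let $\mathcal{L}_2^n(s)$ be the $n$-th Laplace transform of interference in the pico tier, given the serving distance $r$, as defined in the context, and let $G_2$ be the array gain function defined in the context. For each positive integer $u_1$ put $x_{k_1}=\cos\left(\frac{2k_1-1}{2u_1}\pi\right)$, $k_1=1,\dots,u_1$. Then $$\mathcal{L}_2^n(s)=\lim_{u_1\to\infty}\exp\left(-\pi\lambda_2\left(R_L^2-r^2\right)-\frac{\pi^2\lambda_2}{2u_1}\sum_{k_1=1}^{u_1}W_n\left(\frac{x_{k_1}d}{\lambda},s\right)\sqrt{1-x_{k_1}^2}\right),$$ where $W_n$ is given as follows. (i) If $\alpha_2>2$, $$W_n(\omega,s)={}_2F_1\left(-\frac{2}{\alpha_2},N_2^p;1-\frac{2}{\alpha_2};-\frac{nsG_2(\omega)}{N_2^p r^{\alpha_2}}\right)r^2-{}_2F_1\left(-\frac{2}{\alpha_2},N_2^p;1-\frac{2}{\alpha_2};-\frac{nsG_2(\omega)}{N_2^p R_L^{\alpha_2}}\right)R_L^2 .$$ (ii) If $\alpha_2=2$, $$W_n(\omega,s)=\frac{nsG_2(\omega)}{N_2^p}\left(F_y\left(\frac{nsG_2(\omega)}{N_2^pR_L^2}\right)-F_y\left(\frac{nsG_2(\omega)}{N_2^pr^2}\right)\right),$$ where, for $y>0$, $$F_y(y)=N_2^p\ln\left(1+\frac1y\right)-\frac{1}{y(1+y)^{N_2^p-1}}-\sum_{m=1}^{N_2^p-1}\frac{N_2^p}{(1+y)^{N_2^p-m}(N_2^p-m)},$$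 and where at points $\omega$ with $G_2(\omega)=0$ the value of $W_n(\omega,s)$ is defined by continuity, i.e. $W_n(\omega,s)=r^2-R_L^2$.
   Context: Setting (mmWave pico tier, tier 2). A typical user is at the origin of $\mathbb{R}^2$ and is served by a base station at distance $r<R_L$, the nearest one. Given this, the interfering base stations of tier 2 form a homogeneous Poisson point process $\Phi$ of intensity $\lambda_2$ on $\{x\in\mathbb{R}^2:\|x\|>r\}$. Only line-of-sight links, i.e. those with $\|x\|<R_L$ ($R_L$ is the radius of the line-of-sight ball), contribute, with path loss proportional to $\|x\|^{-\alpha_2}$. Array gain: $G_2(\omega)=\dfrac{\sin^2(\pi N_2\omega)}{N_2^2\sin^2(\pi\omega)}$, extended by continuity (value $1$) at integer $\omega$, where $N_2$ is the number of antenna elements. Each interferer $x$ carries an independent random variable $\omega_x$ uniformly distributed on $[-\frac d\lambda,\frac d\lambda]$ ($d$ is the antenna spacing, $\lambda$ the wavelength). Fading: each interferer $x$ carries an independent power fading $|h_{2,x}|^2$ (Nakagami fading with integer parameter $N_2^p$), which is a normalized Gamma random variable with shape $N_2^p$ and mean $1$ (scale $1/N_2^p$). The marks $\omega_x$, $|h_{2,x}|^2$ are independent of each other, across points, and of $\Phi$. The $n$-th Laplace transform of (normalized) interference in tier 2 is $$\mathcal{L}_2^n(s)=\mathbb{E}\left[\exp\left(-ns\sum_{x\in\Phi,\ \|x\|<R_L}G_2(\omega_x)\,|h_{2,x}|^2\,\|x\|^{-\alpha_2}\right)\right].$$ ${}_2F_1$ is the Gauss hypergeometric function (analytically continued to $\mathbb{C}\setminus[1,\infty)$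 in its last argument). *)

theory Defs
  imports "HOL-Probability.Probability" "HOL-Complex_Analysis.Complex_Analysis"
begin

text \<open>
  A point process is represented by its random set of points (all processes here are simple).
  The counting variables are required to be Poisson on bounded Borel sets, where the mean is finite;
  the mean may be 0 (with \<^term>\<open>0 ^ 0 = 1\<close>), which is why the Poisson weights are written out
  instead of using \<^const>\<open>poisson_pmf\<close>, whose rate must be positive.
\<close>

definition homogeneous_ppp ::
  "'w measure \<Rightarrow> real \<Rightarrow> 'a::euclidean_space set \<Rightarrow> ('w \<Rightarrow> 'a set) \<Rightarrow> bool" where
  "homogeneous_ppp M l A \<Phi> \<longleftrightarrow>
     (\<forall>z\<in>space M. \<Phi> z \<subseteq> A \<and> (\<forall>B. bounded B \<longrightarrow> finite (\<Phi> z \<inter> B))) \<and>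
     (\<forall>B\<in>sets borel. bounded B \<longrightarrow> B \<subseteq> A \<longrightarrow>
        (\<lambda>z. card (\<Phi> z \<inter> B)) \<in> measurable M (count_space UNIV) \<and>
        (\<forall>k. measure M {z \<in> space M. card (\<Phi> z \<inter> B) = k} =
             (l * measure lborel B) ^ k / fact k * exp (- (l * measure lborel B)))) \<and>
     (\<forall>(I::nat set) B. finite I \<longrightarrow> (\<forall>i\<in>I. B i \<in> sets borel \<and> bounded (B i) \<and> B i \<subseteq> A) \<longrightarrow>
        disjoint_family_on B I \<longrightarrow>
        prob_space.indep_vars M (\<lambda>_. count_space UNIV) (\<lambda>i z. card (\<Phi> z \<inter> B i)) I)"

text \<open>
  Independent marking with mark law \<^term>\<open>Q\<close>: \<^term>\<open>mk z x\<close> is the mark of the point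
  \<^term>\<open>x \<in> \<Phi> z\<close> (its values off \<^term>\<open>\<Phi> z\<close> are irrelevant). The points admit a measurable
  enumeration \<^term>\<open>X\<close> of random, possibly infinite, length \<^term>\<open>\<kappa>\<close>, along which the marks are
  an i.i.d. sequence with law \<^term>\<open>Q\<close> that is independent of the enumerated points. Independence
  from the enumeration, and not only from the set of points, is what keeps the marks from being
  used to order the points.
\<close>

definition independently_marked ::
  "'w measure \<Rightarrow> 'm measure \<Rightarrow> ('w \<Rightarrow> 'a::euclidean_space set) \<Rightarrow> ('w \<Rightarrow> 'a \<Rightarrow> 'm) \<Rightarrow> bool" where
  "independently_marked M Q \<Phi> mk \<longleftrightarrow>
     (\<exists>(\<kappa> :: 'w \<Rightarrow> enat) (X :: nat \<Rightarrow> 'w \<Rightarrow> 'a) (Y :: nat \<Rightarrow> 'w \<Rightarrow> 'm).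
        \<kappa> \<in> measurable M (count_space UNIV) \<and>
        (\<forall>i. X i \<in> measurable M borel) \<and>
        (\<forall>i. Y i \<in> measurable M Q) \<and>
        (\<forall>z\<in>space M. bij_betw (\<lambda>i. X i z) {i. enat i < \<kappa> z} (\<Phi> z) \<and>
                      (\<forall>i. enat i < \<kappa> z \<longrightarrow> mk z (X i z) = Y i z)) \<and>
        (\<forall>i. distr M Q (Y i) = Q) \<and>
        prob_space.indep_vars M (\<lambda>_. Q) Y UNIV \<and>
        prob_space.indep_set M
          (sets (vimage_algebra (space M) (\<lambda>z. (\<kappa> z, \<lambda>i. X i z))
                   (count_space UNIV \<Otimes>\<^sub>M PiM UNIV (\<lambda>_. borel))))
          (sets (vimage_algebra (space M) (\<lambda>z i. Y i z) (PiM UNIV (\<lambda>_. Q)))))"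

definition array_gain :: "nat \<Rightarrow> real \<Rightarrow> real" where
  "array_gain N w =
     (if w \<in> \<int> then 1 else (sin (pi * real N * w))\<^sup>2 / ((real N)\<^sup>2 * (sin (pi * w))\<^sup>2))"

definition angle_law :: "real \<Rightarrow> real \<Rightarrow> real measure" where
  "angle_law d lam = uniform_measure lborel {- (d / lam) .. d / lam}"

text \<open>
  The normalized Gamma law of integer shape \<^term>\<open>K\<close> and rate \<^term>\<open>K\<close> (mean 1). The first
  argument of \<^const>\<open>erlang_density\<close> is the shape minus one.
\<close>

definition fading_law :: "nat \<Rightarrow> real measure" where
  "fading_law K = density lborel (\<lambda>x. ennreal (erlang_density (K - 1) (real K) x))"

text \<open>
  The arguments \<^term>\<open>w\<close> and \<^term>\<open>h\<close> give the angle and the power fading of the interferers.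
\<close>

definition laplace_interference ::
  "'w measure \<Rightarrow> ('w \<Rightarrow> (real^2) set) \<Rightarrow> ('w \<Rightarrow> real^2 \<Rightarrow> real) \<Rightarrow> ('w \<Rightarrow> real^2 \<Rightarrow> real) \<Rightarrow>
   nat \<Rightarrow> real \<Rightarrow> real \<Rightarrow> nat \<Rightarrow> real \<Rightarrow> real" where
  "laplace_interference M \<Phi> w h N RL \<alpha> n s =
     prob_space.expectation M (\<lambda>z. exp (- (real n * s *
        (\<Sum>x\<in>{x \<in> \<Phi> z. norm x < RL}. array_gain N (w z x) * h z x * norm x powr (- \<alpha>)))))"

text \<open>
  The Gauss hypergeometric function: the value at \<^term>\<open>z\<close> of the (unique) holomorphic
  continuation of the Gauss series to the complex plane cut along the real half-line from 1.
\<close>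

definition hyp2F1 :: "complex \<Rightarrow> complex \<Rightarrow> complex \<Rightarrow> complex \<Rightarrow> complex" where
  "hyp2F1 a b c z =
     (THE v. \<exists>f. f holomorphic_on (- {x. Im x = 0 \<and> 1 \<le> Re x}) \<and>
                 (\<forall>x\<in>ball 0 1. f x = eval_fps (fps_hypergeo [a, b] [c] 1) x) \<and> f z = v)"

text \<open>
  For real parameters and real argument below 1 the value is real, so taking the real part is only
  a change of type.
\<close>

definition hyp2F1_real :: "real \<Rightarrow> real \<Rightarrow> real \<Rightarrow> real \<Rightarrow> real" where
  "hyp2F1_real a b c x = Re (hyp2F1 (of_real a) (of_real b) (of_real c) (of_real x))"

definition F_y :: "nat \<Rightarrow> real \<Rightarrow> real" where
  "F_y K y = real K * ln (1 + 1 / y) - 1 / (y * (1 + y) ^ (K - 1))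
     - (\<Sum>m = 1..K - 1. real K / ((1 + y) ^ (K - m) * real (K - m)))"

definition W :: "nat \<Rightarrow> nat \<Rightarrow> real \<Rightarrow> real \<Rightarrow> real \<Rightarrow> nat \<Rightarrow> real \<Rightarrow> real \<Rightarrow> real" where
  "W N K r RL \<alpha> n w s =
     (if \<alpha> > 2 then
        hyp2F1_real (- 2 / \<alpha>) (real K) (1 - 2 / \<alpha>)
          (- (real n * s * array_gain N w / (real K * r powr \<alpha>))) * r\<^sup>2
        - hyp2F1_real (- 2 / \<alpha>) (real K) (1 - 2 / \<alpha>)
            (- (real n * s * array_gain N w / (real K * RL powr \<alpha>))) * RL\<^sup>2
      else if array_gain N w = 0 then r\<^sup>2 - RL\<^sup>2
      else real n * s * array_gain N w / real K *
        (F_y K (real n * s * array_gain N w / (real K * RL\<^sup>2))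
         - F_y K (real n * s * array_gain N w / (real K * r\<^sup>2))))"

definition cheb_node :: "nat \<Rightarrow> nat \<Rightarrow> real" where
  "cheb_node u k = cos ((2 * real k - 1) / (2 * real u) * pi)"

end

theory Submission
  imports Defs
begin

text \<open>
  Given the points, the marks are i.i.d., so each interferer \<open>x\<close> contributes the factor
  \<open>\<gamma>(\<parallel>x\<parallel>\<^sup>2) = E\<^sub>\<omega>[(1 + c(\<omega>) \<parallel>x\<parallel>\<^sup>-\<^sup>\<alpha>)\<^sup>-\<^sup>K]\<close> with \<open>c(\<omega>) = n s G(\<omega>)/K\<close>, by the Laplace transform of
  the Gamma law. The probability generating functional of the Poisson process turns the expected
  product into \<open>exp(-\<lambda> \<integral>(1 - \<gamma>(\<parallel>x\<parallel>\<^sup>2)) dx)\<close> over the annulus, and in the variable \<open>t = \<parallel>x\<parallel>\<^sup>2\<close> Lebesgue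
  measure of the plane becomes \<open>\<pi> dt\<close>. Both expressions for \<open>W\<close> are differences of an antiderivative of
  \<open>(1 + c t\<^sup>-\<^sup>\<alpha>\<^sup>/\<^sup>2)\<^sup>-\<^sup>K\<close>; for the hypergeometric one this is the differential equation
  \<open>a f(z) + z f'(z) = a (1 - z)\<^sup>-\<^sup>K\<close> with \<open>a = -2/\<alpha>\<close>. There remains the average of \<open>W\<close> over the uniform
  angle, and the substitution \<open>x = cos \<theta>\<close> makes its Gauss-Chebyshev sums midpoint sums of a
  continuous function.
\<close>

section \<open>The hypergeometric function on the cut plane\<close>

text \<open>The arguments of the hypergeometric function are nonpositive but may be large, so the
  Gauss series alone does not reach them, and \<open>hyp2F1\<close> is a definite description:
  existence and uniqueness of the continuation both have to be shown. Solving the differential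
  equation by an integral over the star-shaped cut plane gives existence together with the
  derivative needed later. The exponent \<alpha> = 2 stands apart because there a = -1 and the third
  parameter a + 1 vanishes. On the probabilistic side, the number and the indices of the points in
  the annulus are random, while independence of the marks is stated along a fixed enumeration.
  Products over points are therefore treated as limits of products over i < n in which irrelevant
  indices contribute 1. All factors lie in [0, 1], so dominated convergence by a constant is enough;
  for the marked factors this holds only almost surely, because the fading is nonnegative only
  almost surely.\<close>

definition cut_plane :: "complex set" where
  "cut_plane = - {x. Im x = 0 \<and> 1 \<le> Re x}"

lemma cut_plane_iff: "z \<in> cut_plane \<longleftrightarrow> Im z \<noteq> 0 \<or> Re z < 1"
  by (auto simp: cut_plane_def)

lemma open_cut_plane: "open cut_plane"
proof -
  have "cut_plane = {z. Im z < 0} \<union> {z. Im z > 0} \<union> {z. Re z < 1}"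
    by (auto simp: cut_plane_iff)
  then show ?thesis
    using open_halfspace_Im_gt[of 0] open_halfspace_Im_lt[of 0] open_halfspace_Re_lt[of 1]
    by (metis open_Un)
qed

text \<open>Star-shapedness about 0 serves twice: it gives connectedness, hence uniqueness of the
  continuation, and it keeps the arguments of the averaging integral inside the domain.\<close>

lemma scale_cut_plane:
  assumes "z \<in> cut_plane" "0 \<le> t" "t \<le> 1"
  shows "of_real t * z \<in> cut_plane"
proof (cases "Im z = 0")
  case True
  then have "Re z < 1" using assms by (simp add: cut_plane_iff)
  have "t * Re z < 1"
  proof (cases "Re z \<le> 0")
    case True
    then show ?thesis using assms mult_nonneg_nonpos[of t "Re z"] by linarith
  next
    case False
    then show ?thesis using assms \<open>Re z < 1\<close> mult_left_le_one_le[of "Re z" t] by linarith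
  qed
  then show ?thesis by (simp add: cut_plane_iff)
next
  case False
  then show ?thesis using assms by (cases "t = 0") (auto simp: cut_plane_iff)
qed

lemma connected_cut_plane: "connected cut_plane"
proof (rule starlike_imp_connected)
  have "closed_segment 0 z \<subseteq> cut_plane" if "z \<in> cut_plane" for z
    using scale_cut_plane[OF that] by (auto simp: closed_segment_def scaleR_conv_of_real)
  then show "starlike cut_plane"
    unfolding starlike_def by (intro bexI[of _ 0]) (auto simp: cut_plane_iff)
qed

lemma ball_subset_cut_plane: "ball 0 1 \<subseteq> cut_plane"
proof
  fix z :: complex assume "z \<in> ball 0 1"
  then show "z \<in> cut_plane"
    using abs_Re_le_cmod[of z] by (auto simp: cut_plane_iff)
qed

text \<open>
  After the substitution \<open>y = t\<^sup>1\<^sup>/\<^sup>b\<close> this average is Euler's integral \<open>\<integral>\<^sub>0\<^sup>1 t\<^sup>1\<^sup>/\<^sup>b\<^sup>-\<^sup>1 \<phi>(t z) dt / b\<close>; in the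
  variable \<open>y\<close> the integrand is continuous up to 0.
\<close>

lemma scaling_average:
  fixes \<phi> :: "complex \<Rightarrow> complex" and b :: real
  assumes hol: "\<phi> holomorphic_on cut_plane" and b: "b > 0"
  defines "I \<equiv> \<lambda>z. integral {0..1} (\<lambda>y. \<phi> (of_real (y powr b) * z))"
  shows "I holomorphic_on cut_plane"
    and "z \<in> cut_plane \<Longrightarrow> of_real b * (z * deriv I z) = \<phi> z - I z"
proof -
  have contphi: "continuous_on cut_plane \<phi>"
    using hol by (rule holomorphic_on_imp_continuous_on)
  have contd: "continuous_on cut_plane (deriv \<phi>)"
    using hol open_cut_plane by (intro holomorphic_on_imp_continuous_on holomorphic_deriv)
  have powr1: "0 \<le> y powr b \<and> y powr b \<le> 1" if "y \<in> {0..1}" for y :: real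
    using that b by (auto intro: powr_le1)
  have contpowr: "continuous_on A (\<lambda>y. of_real (y powr b) :: complex)" if "A \<subseteq> {0..1}" for A
    using that b by (intro continuous_intros continuous_on_powr') auto
  have mem: "of_real (y powr b) * x \<in> cut_plane" if "y \<in> {0..1}" "x \<in> cut_plane" for x y
    using powr1[OF that(1)] by (intro scale_cut_plane that(2)) auto
  have contpath: "continuous_on {0..1} (\<lambda>y. \<psi> (of_real (y powr b) * x))"
    if "continuous_on cut_plane \<psi>" "x \<in> cut_plane" for \<psi> :: "complex \<Rightarrow> complex" and x
  proof (rule continuous_on_compose2[OF that(1)])
    show "continuous_on {0..1} (\<lambda>y. of_real (y powr b) * x)"
      by (intro continuous_on_mult contpowr continuous_on_const) auto
    show "(\<lambda>y. of_real (y powr b) * x) ` {0..1} \<subseteq> cut_plane"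
      using mem that(2) by blast
  qed
  \<comment> \<open>Differentiation under the integral sign. It is carried out on a ball because
    Leibniz' rule asks for a convex parameter set, which the cut plane is not.\<close>
  have D: "(I has_field_derivative
      integral {0..1} (\<lambda>y. of_real (y powr b) * deriv \<phi> (of_real (y powr b) * z))) (at z)"
    if z: "z \<in> cut_plane" for z
  proof -
    obtain e where e: "e > 0" "ball z e \<subseteq> cut_plane"
      using open_cut_plane z by (meson open_contains_ball)
    have "((\<lambda>x. integral (cbox 0 1) (\<lambda>y. \<phi> (of_real (y powr b) * x))) has_field_derivative
      integral (cbox 0 1) (\<lambda>y. of_real (y powr b) * deriv \<phi> (of_real (y powr b) * z)))
      (at z within ball z e)"
    proof (rule leibniz_rule_field_derivative[where U = "ball z e" and
          fx = "\<lambda>x y. of_real (y powr b) * deriv \<phi> (of_real (y powr b) * x)"])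
      fix x and t :: real assume x: "x \<in> ball z e" and t: "t \<in> cbox 0 1"
      have *: "of_real (t powr b) * x \<in> cut_plane"
        using x e(2) t by (intro mem) auto
      show "((\<lambda>x. \<phi> (of_real (t powr b) * x)) has_field_derivative
          of_real (t powr b) * deriv \<phi> (of_real (t powr b) * x)) (at x within ball z e)"
      proof (rule has_field_derivative_at_within)
        show "((\<lambda>x. \<phi> (of_real (t powr b) * x)) has_field_derivative
          of_real (t powr b) * deriv \<phi> (of_real (t powr b) * x)) (at x)"
          by (rule DERIV_chain'[where f = "\<lambda>x. of_real (t powr b) * x" and g = \<phi>,
                OF DERIV_cmult_Id holomorphic_derivI[OF hol open_cut_plane *],
                simplified mult.commute[of _ "of_real (t powr b)"]])
      qed
    next
      fix x assume x: "x \<in> ball z e"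
      show "(\<lambda>y. \<phi> (of_real (y powr b) * x)) integrable_on cbox 0 1"
        using contpath[OF contphi, of x] x e(2)
        by (simp add: integrable_continuous_real subset_iff)
    next
      show "continuous_on (ball z e \<times> cbox 0 1)
         (\<lambda>(x, t). of_real (t powr b) * deriv \<phi> (of_real (t powr b) * x))"
      proof -
        let ?c = "\<lambda>p::complex \<times> real. of_real (snd p powr b) :: complex"
        have c: "continuous_on (ball z e \<times> cbox 0 1) ?c"
          by (rule continuous_on_compose2[OF contpowr[OF subset_refl]]) (auto intro: continuous_on_snd)
        have "continuous_on (ball z e \<times> cbox 0 1) (\<lambda>p. deriv \<phi> (?c p * fst p))"
        proof (rule continuous_on_compose2[OF contd])
          show "continuous_on (ball z e \<times> cbox 0 1) (\<lambda>p. ?c p * fst p)"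
            by (intro continuous_on_mult c continuous_on_fst continuous_on_id)
          show "(\<lambda>p. ?c p * fst p) ` (ball z e \<times> cbox 0 1) \<subseteq> cut_plane"
            using subsetD[OF e(2)] by (auto intro!: mem)
        qed
        from continuous_on_mult[OF c this] show ?thesis
          by (simp add: case_prod_beta')
      qed
    qed (use e(1) in simp_all)
    then show ?thesis
      using at_within_open[of z "ball z e"] e(1) by (simp add: I_def)
  qed
  then show "I holomorphic_on cut_plane"
    unfolding holomorphic_on_open[OF open_cut_plane] by blast
  assume z: "z \<in> cut_plane"
  let ?d = "\<lambda>y. of_real (y powr b) * deriv \<phi> (of_real (y powr b) * z)"
  have c1: "continuous_on {0..1} (\<lambda>y. \<phi> (of_real (y powr b) * z))"
    by (rule contpath[OF contphi z])
  then have i1: "(\<lambda>y. \<phi> (of_real (y powr b) * z)) integrable_on {0..1}"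
    by (rule integrable_continuous_real)
  have i2: "?d integrable_on {0..1}"
    by (intro integrable_continuous_real continuous_on_mult contpowr contpath[OF contd z]) auto
  \<comment> \<open>Integration by parts, in the form of the fundamental theorem for y \<phi>(y^b
    z): its derivative combines the integrands of \<open>I z\<close> and of
    \<open>deriv I z\<close>. The interior version of the theorem is used because y^b need not be
    differentiable at 0.\<close>
  have "((\<lambda>y. \<phi> (of_real (y powr b) * z) + of_real b * z * ?d y) has_integral
      (of_real 1 * \<phi> (of_real (1 powr b) * z) - of_real 0 * \<phi> (of_real (0 powr b) * z))) {0..1}"
  proof (rule fundamental_theorem_of_calculus_interior)
    show "continuous_on {0..1} (\<lambda>y. complex_of_real y * \<phi> (of_real (y powr b) * z))"
      by (intro continuous_on_mult c1 continuous_on_of_real continuous_on_id)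
    fix y :: real assume y: "y \<in> {0<..<1}"
    have "((\<lambda>y. of_real (y powr b) * z) has_vector_derivative of_real (b * y powr (b - 1)) * z) (at y)"
      using y by (auto intro!: derivative_eq_intros has_vector_derivative_real_field
            simp flip: has_real_derivative_iff_has_vector_derivative)
    moreover have "(\<phi> has_field_derivative deriv \<phi> (of_real (y powr b) * z)) (at (of_real (y powr b) * z))"
      using y by (intro holomorphic_derivI[OF hol open_cut_plane] mem z) auto
    ultimately have "((\<phi> \<circ> (\<lambda>y. of_real (y powr b) * z)) has_vector_derivative
        (of_real (b * y powr (b - 1)) * z) * deriv \<phi> (of_real (y powr b) * z)) (at y)"
      by (rule field_vector_diff_chain_at)
    then have 1: "((\<lambda>y. \<phi> (of_real (y powr b) * z)) has_vector_derivative
        (of_real (b * y powr (b - 1)) * z) * deriv \<phi> (of_real (y powr b) * z)) (at y)"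
      by (simp add: o_def)
    have 2: "((\<lambda>y. complex_of_real y) has_vector_derivative 1) (at y)"
      using has_vector_derivative_of_real[of "\<lambda>y. y" 1] by (auto intro!: derivative_eq_intros)
    have 3: "y powr b = y * y powr (b - 1)"
      using y by (simp add: powr_mult_base)
    show "((\<lambda>y. complex_of_real y * \<phi> (of_real (y powr b) * z)) has_vector_derivative
        \<phi> (of_real (y powr b) * z) + of_real b * z * ?d y) (at y)"
      using has_vector_derivative_mult[OF 2 1] 
      by (rule has_vector_derivative_eq_rhs) (subst (4) 3, simp add: algebra_simps)
  qed simp
  then have "\<phi> z = integral {0..1} (\<lambda>y. \<phi> (of_real (y powr b) * z) + of_real b * z * ?d y)"
    by (simp add: integral_unique)
  also have "\<dots> = I z + of_real b * z * integral {0..1} ?d"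
    unfolding I_def using i1 integrable_on_mult_right[OF i2, of "of_real b * z"]
    by (subst integral_add) auto
  finally show "of_real b * (z * deriv I z) = \<phi> z - I z"
    using DERIV_imp_deriv[OF D[OF z]] by simp
qed

text \<open>A telescoping sum. It writes ((1 - w)^(-K) - 1) / w as a function that is holomorphic at
  0 by inspection, so no removable singularity has to be discussed.\<close>

lemma mult_sum_inverse_powers:
  fixes w :: complex
  assumes "w \<noteq> 1"
  shows "w * (\<Sum>j=1..K. inverse ((1 - w) ^ j)) = inverse ((1 - w) ^ K) - 1"
proof (induction K)
  case (Suc K)
  have "w * inverse ((1 - w) ^ Suc K) = inverse ((1 - w) ^ Suc K) - inverse ((1 - w) ^ K)"
    using assms by (simp add: field_simps)
  then show ?case using Suc by (simp add: ring_distribs)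
qed simp

text \<open>
  The Gauss series with parameters \<open>a, K; a + 1\<close> has coefficients \<open>a/(a + n)\<close> times those of
  \<open>(1 - z)\<^sup>-\<^sup>K\<close>, which as an identity of functions is this differential equation. Subtracting the
  constant term first is what makes the integral converge for \<open>-1 < a < 0\<close>.
\<close>

lemma hypergeometric_ODE_solution:
  fixes a :: real
  assumes a: "-1 < a"
  obtains f where "f holomorphic_on cut_plane" "f 0 = 1"
    "\<And>z. z \<in> cut_plane \<Longrightarrow> of_real a * f z + z * deriv f z = of_real a * inverse ((1 - z) ^ K)"
proof -
  \<comment> \<open>Makes the exponent 1/b - 1 of Euler's integral equal to a, so that b
    \<open>I z\<close> is the integral of t^a \<phi>(t z) over [0, 1], whose weight is integrable as
    a > -1.\<close>
  define b where "b = 1 / (a + 1)"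
  have b: "b > 0" "b * (a + 1) = 1" using a by (auto simp: b_def)
  define \<phi> where "\<phi> = (\<lambda>w::complex. \<Sum>j=1..K. inverse ((1 - w) ^ j))"
  have ne: "w \<noteq> 1" if "w \<in> cut_plane" for w using that by (auto simp: cut_plane_iff)
  have hol: "\<phi> holomorphic_on cut_plane"
    unfolding \<phi>_def by (intro holomorphic_intros) (use ne in auto)
  define I where "I = (\<lambda>z. integral {0..1} (\<lambda>y. \<phi> (of_real (y powr b) * z)))"
  have I: "I holomorphic_on cut_plane"
    unfolding I_def by (rule scaling_average(1)[OF hol b(1)])
  have ODE: "of_real b * (z * deriv I z) = \<phi> z - I z" if "z \<in> cut_plane" for z
    unfolding I_def by (rule scaling_average(2)[OF hol b(1) that])
  \<comment> \<open>On power series, a z times the integral of t^a \<phi>(t z) multiplies the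
    coefficient of z^n in (1 - z)^(-K) - 1 by a/(a + n); the summand 1 restores the constant
    term.\<close>
  define f where "f = (\<lambda>z. 1 + of_real (a * b) * (z * I z))"
  show thesis
  proof
    show "f holomorphic_on cut_plane"
      unfolding f_def by (intro holomorphic_intros I)
    show "f 0 = 1" by (simp add: f_def)
    fix z assume z: "z \<in> cut_plane"
    have dI: "(I has_field_derivative deriv I z) (at z)"
      by (rule holomorphic_derivI[OF I open_cut_plane z])
    have "(f has_field_derivative of_real (a * b) * (I z + z * deriv I z)) (at z)"
      unfolding f_def by (rule derivative_eq_intros dI refl | simp)+
    then have df: "deriv f z = of_real (a * b) * (I z + z * deriv I z)"
      by (rule DERIV_imp_deriv)
    have sum: "z * \<phi> z = inverse ((1 - z) ^ K) - 1"
      unfolding \<phi>_def using mult_sum_inverse_powers[OF ne[OF z]] .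
    have ab: "of_real a * of_real b = 1 - (of_real b :: complex)"
      using b(2) by (metis add_diff_cancel_right' distrib_left mult.commute mult.right_neutral of_real_1 of_real_diff of_real_mult)
    have "of_real a * f z + z * deriv f z = of_real a
       + of_real a * z * (of_real a * of_real b * I z + of_real b * I z + of_real b * (z * deriv I z))"
      by (subst df) (simp add: f_def algebra_simps)
    also have "\<dots> = of_real a + of_real a * (z * \<phi> z)"
      unfolding ab ODE[OF z] by (simp add: algebra_simps)
    also have "\<dots> = of_real a * inverse ((1 - z) ^ K)"
      unfolding sum by (simp add: algebra_simps)
    finally show "of_real a * f z + z * deriv f z = of_real a * inverse ((1 - z) ^ K)" .
  qed
qed

text \<open>The binomial series for the exponent -K. The sign of the generalized binomial
  coefficient cancels that of (-u)^n, which leaves Pochhammer symbols as in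
  \<open>fps_hypergeo\<close>.\<close>

lemma has_fps_expansion_inverse_power:
  "(\<lambda>z::complex. inverse ((1 - z) ^ K)) has_fps_expansion
     Abs_fps (\<lambda>n. pochhammer (of_nat K) n / fact n)"
proof (rule has_fps_expansionI)
  have "(\<lambda>n. fps_nth (Abs_fps (\<lambda>n. pochhammer (of_nat K) n / fact n)) n * u ^ n)
          sums inverse ((1 - u) ^ K)" if "u \<in> ball 0 1" for u :: complex
  proof -
    have "(\<lambda>n. ((- of_nat K) gchoose n) * (-u) ^ n) sums (1 + (-u)) powr (- of_nat K)"
      using that by (intro gen_binomial_complex) auto
    moreover have "((- of_nat K) gchoose n) * (-u) ^ n = pochhammer (of_nat K) n / fact n * u ^ n" for n
    proof -
      have "(-1) ^ n * (-1) ^ n = (1 :: complex)" by (simp flip: power_mult_distrib)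
      then show ?thesis by (subst power_minus) (simp add: gbinomial_pochhammer)
    qed
    moreover have "(1 + (-u)) powr (- of_nat K) = inverse ((1 - u) ^ K)"
      using that by (subst powr_minus, subst powr_nat) auto
    ultimately show ?thesis by simp
  qed
  moreover have "eventually (\<lambda>u. u \<in> ball 0 1) (nhds (0::complex))"
    by (rule eventually_nhds_in_open) auto
  ultimately show "\<forall>\<^sub>F u in nhds 0. (\<lambda>n. fps_nth (Abs_fps (\<lambda>n. pochhammer (of_nat K) n / fact n)) n * u ^ n)
          sums inverse ((1 - u :: complex) ^ K)"
    by (blast intro: eventually_mono)
qed

text \<open>Comparing coefficients in the equation gives (a + n) F_n = a (K)_n / n!. No factor a + n
  vanishes, so the equation alone determines every coefficient, the constant one included, and a /
  (a + n) = (a)_n / (a + 1)_n identifies them. Holomorphy on the unit disc then makes the series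
  converge to f on all of it.\<close>

lemma hypergeometric_ODE_imp_eval_fps:
  fixes a :: real
  assumes a: "-1 < a" "a \<noteq> 0"
  assumes f: "f holomorphic_on cut_plane"
  assumes ODE: "\<And>z. z \<in> cut_plane \<Longrightarrow>
    of_real a * f z + z * deriv f z = of_real a * inverse ((1 - z) ^ K)"
  assumes x: "x \<in> ball 0 1"
  shows "f x = eval_fps (fps_hypergeo [of_real a, of_nat K] [of_real (a + 1)] 1) x"
proof -
  define F where "F = fps_expansion f 0"
  define H :: "complex fps" where "H = fps_hypergeo [of_real a, of_nat K] [of_real (a + 1)] 1"
  have zero: "0 \<in> cut_plane" by (simp add: cut_plane_iff)
  have F: "f has_fps_expansion F"
    unfolding F_def by (rule has_fps_expansion_fps_expansion[OF open_cut_plane zero f])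
  have "(\<lambda>z. of_real a * f z + z * deriv f z) has_fps_expansion
      fps_const (of_real a) * F + fps_X * fps_deriv F"
    by (intro fps_expansion_intros F)
  moreover have "eventually (\<lambda>z. of_real a * f z + z * deriv f z = of_real a * inverse ((1 - z) ^ K)) (nhds 0)"
    using eventually_nhds_in_open[OF open_cut_plane zero] by eventually_elim (rule ODE)
  ultimately have "(\<lambda>z. of_real a * inverse ((1 - z) ^ K)) has_fps_expansion
      fps_const (of_real a) * F + fps_X * fps_deriv F"
    using has_fps_expansion_cong[OF _ refl] by fast
  moreover have "(\<lambda>z::complex. of_real a * inverse ((1 - z) ^ K)) has_fps_expansion
      fps_const (of_real a) * Abs_fps (\<lambda>n. pochhammer (of_nat K) n / fact n)"
    by (intro fps_expansion_intros has_fps_expansion_inverse_power)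
  ultimately have eq: "fps_const (of_real a) * F + fps_X * fps_deriv F =
      fps_const (of_real a) * Abs_fps (\<lambda>n. pochhammer (of_nat K) n / fact n)"
    using fps_expansion_unique_complex by blast
  have ne: "complex_of_real (a + real n) \<noteq> 0" for n
  proof -
    have "a + real n \<noteq> 0" using a by (cases n) auto
    then show ?thesis by (simp only: of_real_eq_0_iff not_False_eq_True)
  qed
  have coeff: "fps_nth F n = fps_nth H n" for n
  proof -
    have "of_real (a + n) * fps_nth F n = of_real a * (pochhammer (of_nat K) n / fact n)"
      using arg_cong[OF eq, of "\<lambda>G. fps_nth G n"] by (cases n) (auto simp: algebra_simps)
    then have 1: "fps_nth F n = of_real a * (pochhammer (of_nat K) n / fact n) / of_real (a + n)"
      using ne[of n] by (metis nonzero_mult_div_cancel_left)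
    have "of_real a * pochhammer (of_real (a + 1)) n = pochhammer (of_real a :: complex) (Suc n)"
      by (simp add: pochhammer_rec)
    also have "\<dots> = of_real (a + n) * pochhammer (of_real a) n"
      by (simp add: pochhammer_Suc mult.commute)
    finally have 2: "of_real a * pochhammer (of_real (a + 1)) n
        = of_real (a + n) * pochhammer (of_real a :: complex) n" .
    have 3: "pochhammer (of_real (a + 1) :: complex) n \<noteq> 0"
      using a pochhammer_pos[of "a + 1" n] by (simp only: pochhammer_of_real of_real_eq_0_iff) simp
    show ?thesis
    proof -
      have "of_real a / of_real (a + n) = pochhammer (of_real a :: complex) n / pochhammer (of_real (a + 1)) n"
        using 2 by (simp only: frac_eq_eq[OF ne 3] mult.commute)
      moreover have "fps_nth F n = of_real a / of_real (a + n) * (pochhammer (of_nat K) n / fact n)"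
        unfolding 1 by simp
      ultimately show ?thesis by (simp add: H_def)
    qed
  qed
  have "(\<lambda>n. (deriv ^^ n) f 0 / fact n * (x - 0) ^ n) sums f x"
    by (rule holomorphic_power_series[OF holomorphic_on_subset[OF f ball_subset_cut_plane] x])
  then have "(\<lambda>n. fps_nth H n * x ^ n) sums f x"
    by (simp add: F_def fps_expansion_def flip: coeff)
  then show ?thesis
    unfolding eval_fps_def H_def by (rule sums_unique)
qed

text \<open>Existence for the definite description comes from the solution of the differential
  equation; uniqueness comes from the identity theorem, since the cut plane is connected and
  contains the unit disc.\<close>

lemma hyp2F1_cut_plane:
  fixes a :: real
  assumes "-1 < a" "a \<noteq> 0"
  obtains f where "f holomorphic_on cut_plane" "f 0 = 1"
    "\<And>z. z \<in> cut_plane \<Longrightarrow> of_real a * f z + z * deriv f z = of_real a * inverse ((1 - z) ^ K)"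
    "\<And>z. z \<in> cut_plane \<Longrightarrow> hyp2F1 (of_real a) (of_nat K) (of_real (a + 1)) z = f z"
proof -
  obtain f where f: "f holomorphic_on cut_plane" "f 0 = 1"
    and ODE: "\<And>z. z \<in> cut_plane \<Longrightarrow> of_real a * f z + z * deriv f z = of_real a * inverse ((1 - z) ^ K)"
    using hypergeometric_ODE_solution[OF assms(1)] by metis
  note ev = hypergeometric_ODE_imp_eval_fps[OF assms f(1) ODE]
  have "hyp2F1 (of_real a) (of_nat K) (of_real (a + 1)) z = f z" if z: "z \<in> cut_plane" for z
    unfolding hyp2F1_def cut_plane_def[symmetric]
  proof (rule the_equality)
    show "\<exists>g. g holomorphic_on cut_plane \<and> (\<forall>x\<in>ball 0 1. g x =
        eval_fps (fps_hypergeo [of_real a, of_nat K] [of_real (a + 1)] 1) x) \<and> g z = f z"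
      using f(1) ev by blast
    fix v assume "\<exists>g. g holomorphic_on cut_plane \<and> (\<forall>x\<in>ball 0 1. g x =
        eval_fps (fps_hypergeo [of_real a, of_nat K] [of_real (a + 1)] 1) x) \<and> g z = v"
    then obtain g where g: "g holomorphic_on cut_plane" "g z = v"
      "\<forall>x\<in>ball 0 1. g x = eval_fps (fps_hypergeo [of_real a, of_nat K] [of_real (a + 1)] 1) x"
      by blast
    have "g z = f z"
      by (rule analytic_continuation_open[OF open_ball open_cut_plane _ connected_cut_plane
            ball_subset_cut_plane g(1) f(1) _ z]) (use g(3) ev in auto)
    with g(2) show "v = f z" by simp
  qed
  then show thesis using that[OF f ODE] by blast
qed

text \<open>With p(t) = -c t^(1/a) one has p' = p / (a t), so the derivative of t f(p(t)) is f(p) +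
  p f'(p) / a, and the differential equation turns this into (1 - p)^(-K). Since p is nonpositive,
  it never meets the cut. The use is a = -2/\<alpha>, where the exponent 1/a is -\<alpha>/2.\<close>

lemma hyp2F1_real_derivative:
  assumes a: "-1 < a" "a < 0" and c: "c \<ge> 0" and t: "t > 0"
  shows "((\<lambda>t. hyp2F1_real a (real K) (1 + a) (- (c * t powr (1 / a))) * t)
     has_real_derivative inverse ((1 + c * t powr (1 / a)) ^ K)) (at t)"
proof -
  obtain f where f: "f holomorphic_on cut_plane"
    and ODE: "\<And>z. z \<in> cut_plane \<Longrightarrow> of_real a * f z + z * deriv f z = of_real a * inverse ((1 - z) ^ K)"
    and eq: "\<And>z. z \<in> cut_plane \<Longrightarrow> hyp2F1 (of_real a) (of_nat K) (of_real (a + 1)) z = f z"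
    using hyp2F1_cut_plane[of a K] a by (metis less_irrefl)
  define p where "p = (\<lambda>t. - (c * t powr (1 / a)))"
  have mem: "of_real (p t) \<in> cut_plane" for t
    using mult_nonneg_nonneg[OF c powr_ge_zero[of t "1/a"]] by (simp add: cut_plane_iff p_def)
  have h: "hyp2F1_real a (real K) (1 + a) (p t) = Re (f (of_real (p t)))" for t
    using eq[OF mem[of t]] by (simp add: hyp2F1_real_def add.commute)
  define D where "D = deriv f (of_real (p t))"
  have "((\<lambda>x::real. Re (f (of_real x))) has_real_derivative Re D) (at (p t))"
  proof -
    have "((f \<circ> of_real) has_vector_derivative 1 * D) (at (p t))"
      unfolding D_def
    proof (rule field_vector_diff_chain_at)
      show "(complex_of_real has_vector_derivative 1) (at (p t))"
        using has_vector_derivative_of_real[of "\<lambda>y. y" 1] by (auto intro!: derivative_eq_intros)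
    qed (rule holomorphic_derivI[OF f open_cut_plane mem])
    then have "((\<lambda>x. Re ((f \<circ> of_real) x)) has_vector_derivative Re (1 * D)) (at (p t))"
      by (rule bounded_linear.has_vector_derivative[OF bounded_linear_Re])
    then show ?thesis
      by (simp add: o_def has_real_derivative_iff_has_vector_derivative)
  qed
  moreover have "(p has_real_derivative (p t / (a * t))) (at t)"
  proof -
    have "((\<lambda>t. t powr (1 / a)) has_real_derivative (1 / a * t powr (1 / a - 1))) (at t)"
      by (rule has_real_derivative_powr[OF t])
    from DERIV_cmult[OF this, of "- c"] show ?thesis
      using t by (simp add: p_def powr_diff)
  qed
  ultimately have "((\<lambda>t. Re (f (of_real (p t)))) has_real_derivative Re D * (p t / (a * t))) (at t)"
    by (rule DERIV_chain2)
  from DERIV_mult[OF this DERIV_ident]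
  have "((\<lambda>t. Re (f (of_real (p t))) * t) has_real_derivative
      Re D * (p t / (a * t)) * t + Re (f (of_real (p t)))) (at t)"
    by (simp add: mult.commute add.commute)
  moreover have "Re D * (p t / (a * t)) * t + Re (f (of_real (p t))) = inverse ((1 - p t) ^ K)"
  proof -
    have "Re (of_real a * f (of_real (p t)) + of_real (p t) * D)
        = Re (of_real a * inverse ((1 - of_real (p t)) ^ K))"
      using ODE[OF mem[of t]] by (simp add: D_def)
    also have "of_real a * inverse ((1 - of_real (p t)) ^ K) = (of_real (a * inverse ((1 - p t) ^ K)) :: complex)"
      by simp
    finally have "a * Re (f (of_real (p t))) + p t * Re D = a * inverse ((1 - p t) ^ K)"
      by (simp only: Re_complex_of_real) simp
    then show ?thesis using a t by (simp add: field_simps)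
  qed
  ultimately show ?thesis
    unfolding h[unfolded p_def] by (simp add: p_def)
qed

section \<open>Antiderivatives\<close>

lemma DERIV_inverse_power_add_1:
  fixes y :: real
  assumes "y > 0"
  shows "((\<lambda>y. inverse ((1 + y) ^ k)) has_real_derivative - real k * inverse ((1 + y) ^ Suc k)) (at y)"
proof (induction k)
  case (Suc k)
  have "((\<lambda>y. inverse (1 + y)) has_real_derivative - inverse ((1 + y) ^ 2)) (at y)"
    using assms by (auto intro!: derivative_eq_intros simp: power2_eq_square)
  note D = DERIV_mult[OF Suc.IH this]
  have eq: "(\<lambda>y. inverse ((1 + y) ^ Suc k)) = (\<lambda>y::real. inverse ((1 + y) ^ k) * inverse (1 + y))"
    by (simp add: fun_eq_iff mult.commute)
  have "- real k * inverse (q * p) * inverse q + - inverse (q\<^sup>2) * inverse p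
      = - real (Suc k) * inverse (q * (q * p))" for q p :: real
    by (simp add: algebra_simps power2_eq_square)
  from this[of "1 + y" "(1 + y) ^ k"] show ?case
    unfolding eq by (intro DERIV_cong[OF D]) simp
qed simp

lemma inverse_mult_inverse_add_1:
  fixes y :: real
  assumes "y > 0"
  shows "inverse y * inverse (1 + y) = inverse y - inverse (1 + y)"
  using assms by (simp add: field_simps)

text \<open>A partial fraction expansion built by induction: the derivative of each further summand
  raises the power of 1 + y by one, because 1/(y (1 + y)) = 1/y - 1/(1 + y). The logarithm and the
  finite sum in \<open>F_y\<close> have this shape after reversing the sum by j = K - m.\<close>

lemma DERIV_ln_minus_partial_sum:
  fixes y :: real
  assumes "y > 0"
  shows "((\<lambda>y. ln (1 + 1 / y) - (\<Sum>j=1..k. 1 / ((1 + y) ^ j * real j))) has_real_derivative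
    - (inverse y * inverse ((1 + y) ^ Suc k))) (at y)"
proof (induction k)
  case 0
  have "((\<lambda>y. ln (1 + 1 / y)) has_real_derivative - (inverse y * inverse (1 + y))) (at y)"
    using assms by (auto intro!: derivative_eq_intros simp: add_pos_pos field_simps)
  then show ?case by simp
next
  case (Suc k)
  have "((\<lambda>y. 1 / real (Suc k) * inverse ((1 + y) ^ Suc k)) has_real_derivative
      - inverse ((1 + y) ^ Suc (Suc k))) (at y)"
    using DERIV_cmult[OF DERIV_inverse_power_add_1[OF assms, of "Suc k"], of "1 / real (Suc k)"]
    by (simp del: of_nat_Suc)
  note D = DERIV_diff[OF Suc.IH this]
  have eq: "(\<lambda>y. ln (1 + 1 / y) - (\<Sum>j=1..Suc k. 1 / ((1 + y) ^ j * real j))) =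
     (\<lambda>y. ln (1 + 1 / y) - (\<Sum>j=1..k. 1 / ((1 + y) ^ j * real j))
        - 1 / real (Suc k) * inverse ((1 + y) ^ Suc k))"
    by (simp add: fun_eq_iff inverse_eq_divide del: of_nat_Suc power_Suc)
  have "((\<lambda>y. ln (1 + 1 / y) - (\<Sum>j=1..Suc k. 1 / ((1 + y) ^ j * real j))) has_real_derivative
    - (inverse y * inverse ((1 + y) ^ Suc k)) + inverse ((1 + y) ^ Suc (Suc k))) (at y)"
    unfolding eq by (rule DERIV_cong[OF D]) simp
  moreover have "- (inverse y * inverse ((1 + y) ^ Suc k)) + inverse ((1 + y) ^ Suc (Suc k))
      = - (inverse y * inverse ((1 + y) ^ Suc (Suc k)))"
    using inverse_mult_inverse_add_1[OF assms]
    unfolding power_Suc inverse_mult_distrib by algebra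
  ultimately show ?case by simp
qed

text \<open>The substitution y = c/t turns (1 + c/t)^(-K) dt into a multiple of y^(-2) (1 + y)^(-K)
  dy, which is why \<open>F_y\<close> occurs for \<alpha> = 2. In the derivative the terms 1/(y (1 +
  y)^K) come with the weights -K, K - 1 and 1, which cancel; the last weight arises from splitting
  1/(y^2 (1 + y)^(K-1)).\<close>

lemma DERIV_F_y:
  assumes y: "y > 0" and K: "K \<ge> 1"
  shows "(F_y K has_real_derivative inverse (y\<^sup>2 * (1 + y) ^ K)) (at y)"
proof -
  obtain k where k: "K = Suc k" using K by (cases K) auto
  have sum: "(\<Sum>m = 1..K - 1. real K / ((1 + y) ^ (K - m) * real (K - m)))
      = real K * (\<Sum>j=1..k. 1 / ((1 + y) ^ j * real j))" for y :: real
  proof -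
    have "(\<Sum>m = 1..k. real K / ((1 + y) ^ (K - m) * real (K - m)))
        = (\<Sum>j=1..k. real K / ((1 + y) ^ j * real j))"
      by (rule sum.reindex_bij_witness[of _ "\<lambda>j. K - j" "\<lambda>m. K - m"]) (auto simp: k)
    then show ?thesis by (simp add: k sum_distrib_left)
  qed
  have F: "F_y K = (\<lambda>y. real K * (ln (1 + 1 / y) - (\<Sum>j=1..k. 1 / ((1 + y) ^ j * real j)))
      - inverse y * inverse ((1 + y) ^ k))"
    unfolding F_y_def sum by (simp add: k fun_eq_iff algebra_simps inverse_eq_divide)
  have "((\<lambda>y. inverse y) has_real_derivative - inverse (y\<^sup>2)) (at y)"
    using y by (auto intro!: derivative_eq_intros simp: power2_eq_square)
  from DERIV_diff[OF DERIV_cmult[OF DERIV_ln_minus_partial_sum[OF y, of k], of "real K"]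
      DERIV_mult[OF this DERIV_inverse_power_add_1[OF y, of k]]]
  have "(F_y K has_real_derivative
      real K * (- (inverse y * inverse ((1 + y) ^ Suc k)))
      - (- inverse (y\<^sup>2) * inverse ((1 + y) ^ k) + (- real k * inverse ((1 + y) ^ Suc k)) * inverse y)) (at y)"
    unfolding F .
  moreover have "real K * (- (inverse y * inverse ((1 + y) ^ Suc k)))
      - (- inverse (y\<^sup>2) * inverse ((1 + y) ^ k) + (- real k * inverse ((1 + y) ^ Suc k)) * inverse y)
      = inverse (y\<^sup>2 * (1 + y) ^ K)"
    using inverse_mult_inverse_add_1[OF y]
    unfolding k power_Suc power2_eq_square inverse_mult_distrib of_nat_Suc by algebra
  ultimately show ?thesis by simp
qed

lemma array_gain_nonneg: "array_gain N w \<ge> 0"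
  by (simp add: array_gain_def)

text \<open>In both regimes \<open>W\<close> is an antiderivative at the squared inner radius minus
  its value at the squared outer radius, hence the minus sign. This common integral is all that is
  used about \<open>W\<close> afterwards.\<close>

lemma W_eq_integral:
  assumes r: "0 < r" "r < RL" and \<alpha>: "\<alpha> \<ge> 2" and s: "s > 0" and K: "K \<ge> 1" and n: "n \<ge> 1"
  shows "((\<lambda>t. inverse ((1 + real n * s * array_gain N w / real K * t powr (- \<alpha> / 2)) ^ K))
     has_integral - W N K r RL \<alpha> n w s) {r\<^sup>2..RL\<^sup>2}"
proof -
  define c where "c = real n * s * array_gain N w / real K"
  have c: "c \<ge> 0" using s by (simp add: c_def array_gain_nonneg)
  have le: "r\<^sup>2 \<le> RL\<^sup>2" using r by (intro power_mono) auto
  have pos: "t > 0" if "t \<in> {r\<^sup>2..RL\<^sup>2}" for t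
    using that r(1) by (auto intro: less_le_trans[of _ "r\<^sup>2"])
  have "\<exists>F. (\<forall>t\<in>{r\<^sup>2..RL\<^sup>2}. (F has_real_derivative inverse ((1 + c * t powr (- \<alpha> / 2)) ^ K)) (at t))
      \<and> W N K r RL \<alpha> n w s = F (r\<^sup>2) - F (RL\<^sup>2)"
  proof (cases "\<alpha> > 2")
    case True
    define F where "F = (\<lambda>t. hyp2F1_real (- 2 / \<alpha>) (real K) (1 + (- 2 / \<alpha>)) (- (c * t powr (1 / (- 2 / \<alpha>)))) * t)"
    have "(F has_real_derivative inverse ((1 + c * t powr (1 / (- 2 / \<alpha>))) ^ K)) (at t)"
      if "t \<in> {r\<^sup>2..RL\<^sup>2}" for t
      unfolding F_def using True by (intro hyp2F1_real_derivative c pos[OF that]) (auto simp: field_simps)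
    moreover have "F (q\<^sup>2) = hyp2F1_real (- 2 / \<alpha>) (real K) (1 - 2 / \<alpha>)
          (- (real n * s * array_gain N w / (real K * q powr \<alpha>))) * q\<^sup>2" if "q > 0" for q
    proof -
      have "(q\<^sup>2) powr (1 / (- 2 / \<alpha>)) = (q powr 2) powr (1 / (- 2 / \<alpha>))"
        using that by (simp add: powr_numeral)
      also have "\<dots> = q powr - \<alpha>" by (simp add: powr_powr)
      also have "\<dots> = 1 / q powr \<alpha>" by (simp add: powr_minus_divide)
      finally have "c * (q\<^sup>2) powr (1 / (- 2 / \<alpha>)) = real n * s * array_gain N w / (real K * q powr \<alpha>)"
        by (simp add: c_def)
      then show ?thesis by (simp add: F_def)
    qed
    ultimately show ?thesis using True r by (intro exI[of _ F]) (simp add: W_def)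
  next
    case False
    with \<alpha> have \<alpha>2: "\<alpha> = 2" by simp
    have powr: "t powr (- \<alpha> / 2) = inverse t" if "t > 0" for t
      using that by (simp add: \<alpha>2 powr_minus)
    show ?thesis
    proof (cases "c = 0")
      case True
      then have "array_gain N w = 0" using s K n by (simp add: c_def)
      then have "W N K r RL \<alpha> n w s = r\<^sup>2 - RL\<^sup>2" by (simp add: W_def \<alpha>2)
      \<comment> \<open>At a zero of the array gain the integrand is the constant 1, and its
        antiderivative t yields the value assigned to \<open>W\<close> there.\<close>
      then show ?thesis using True by (intro exI[of _ "\<lambda>t. t"]) simp
    next
      case False
      with c have c: "c > 0" by simp
      then have "array_gain N w \<noteq> 0" by (auto simp: c_def)
      then have "W N K r RL \<alpha> n w s = c * (F_y K (c / RL\<^sup>2) - F_y K (c / r\<^sup>2))"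
        by (simp add: W_def \<alpha>2 c_def)
      moreover have "((\<lambda>t. - (c * F_y K (c / t))) has_real_derivative
          inverse ((1 + c * t powr (- \<alpha> / 2)) ^ K)) (at t)" if "t \<in> {r\<^sup>2..RL\<^sup>2}" for t
      proof -
        have t: "t > 0" using pos that .
        have 1: "((\<lambda>t. c / t) has_real_derivative - c / t\<^sup>2) (at t)"
          using t by (auto intro!: derivative_eq_intros simp: power2_eq_square)
        have 2: "c / t > 0" using c t by simp
        have "((\<lambda>t. - c * F_y K (c / t)) has_real_derivative
            - c * (inverse ((c / t)\<^sup>2 * (1 + c / t) ^ K) * (- c / t\<^sup>2))) (at t)"
          by (rule DERIV_cmult[OF DERIV_chain2[OF DERIV_F_y[OF 2 K] 1]])
        moreover have "- c * (inverse ((c / t)\<^sup>2 * (1 + c / t) ^ K) * (- c / t\<^sup>2))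
            = inverse ((1 + c * t powr (- \<alpha> / 2)) ^ K)"
          unfolding powr[OF t] using c t by (simp add: field_simps power2_eq_square)
        ultimately show ?thesis by simp
      qed
      ultimately show ?thesis
        by (intro exI[of _ "\<lambda>t. - (c * F_y K (c / t))"]) (simp add: algebra_simps)
    qed
  qed
  then obtain F where F: "\<And>t. t \<in> {r\<^sup>2..RL\<^sup>2} \<Longrightarrow>
      (F has_real_derivative inverse ((1 + c * t powr (- \<alpha> / 2)) ^ K)) (at t)"
    and W: "W N K r RL \<alpha> n w s = F (r\<^sup>2) - F (RL\<^sup>2)" by blast
  have "((\<lambda>t. inverse ((1 + c * t powr (- \<alpha> / 2)) ^ K)) has_integral F (RL\<^sup>2) - F (r\<^sup>2)) {r\<^sup>2..RL\<^sup>2}"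
    using F by (intro fundamental_theorem_of_calculus le)
      (auto simp flip: has_real_derivative_iff_has_vector_derivative intro: has_field_derivative_at_within)
  then show ?thesis by (simp add: W c_def)
qed

section \<open>Continuity of the array gain\<close>

text \<open>The quotient sin(N x) / sin x, that is, the Chebyshev polynomial of the second kind
  U_(N-1) at cos x. The recursion is the addition formula divided by sin x; it has no denominator,
  so continuity at the zeros of sin is immediate.\<close>

primrec sin_ratio :: "nat \<Rightarrow> real \<Rightarrow> real" where
  "sin_ratio 0 x = 0"
| "sin_ratio (Suc N) x = sin_ratio N x * cos x + cos (real N * x)"

lemma sin_ratio_mult_sin: "sin_ratio N x * sin x = sin (real N * x)"
proof (induction N)
  case (Suc N)
  have "sin (real (Suc N) * x) = sin (real N * x + x)" by (simp add: algebra_simps)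
  then show ?case using Suc by (simp add: sin_add algebra_simps flip: Suc)
qed simp

text \<open>Where sin vanishes, cos is 1 or -1, so up to sign each step of the recursion adds 1. The
  square removes the sign and gives exactly the value 1 of the array gain at integers.\<close>

lemma sin_ratio_at_zero:
  assumes "sin x = 0"
  shows "(sin_ratio N x)\<^sup>2 = (real N)\<^sup>2"
proof -
  have c: "cos x * cos x = 1" using assms sin_cos_squared_add[of x] by (simp add: power2_eq_square)
  have *: "sin_ratio N x * cos x = real N * cos (real N * x)"
  proof (induction N)
    case (Suc N)
    have "cos (real (Suc N) * x) = cos (real N * x + x)" by (simp add: algebra_simps)
    then show ?case using Suc assms by (simp add: cos_add algebra_simps)
  qed simp
  have "sin (real N * x) = 0" using sin_ratio_mult_sin[of N x] assms by simp
  then have "(cos (real N * x))\<^sup>2 = 1" using sin_cos_squared_add[of "real N * x"] by simp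
  then have "(sin_ratio N x * cos x)\<^sup>2 = (real N)\<^sup>2" unfolding * by (simp add: power_mult_distrib)
  then have "(sin_ratio N x)\<^sup>2 * (cos x * cos x) = (real N)\<^sup>2"
    by (simp add: power2_eq_square mult_ac)
  then show ?thesis unfolding c by simp
qed

lemma array_gain_eq_sin_ratio:
  assumes "N \<ge> 1"
  shows "array_gain N w = (sin_ratio N (pi * w))\<^sup>2 / (real N)\<^sup>2"
proof (cases "w \<in> \<int>")
  case True
  then have "sin (pi * w) = 0" by (auto elim!: Ints_cases simp: mult.commute)
  then show ?thesis using True assms by (simp add: array_gain_def sin_ratio_at_zero)
next
  case False
  then have "sin (pi * w) \<noteq> 0" by (auto simp: sin_zero_iff_int2)
  moreover have "sin (pi * real N * w) = sin_ratio N (pi * w) * sin (pi * w)"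
    using sin_ratio_mult_sin[of N "pi * w"] by (simp add: mult_ac)
  ultimately show ?thesis using False by (simp add: array_gain_def power_mult_distrib)
qed

lemma continuous_on_array_gain:
  assumes "N \<ge> 1"
  shows "continuous_on A (array_gain N)"
proof -
  have "continuous_on A (\<lambda>w. sin_ratio N (pi * w))"
    by (induction N) (auto intro!: continuous_intros)
  then have "continuous_on A (\<lambda>w. (sin_ratio N (pi * w))\<^sup>2 / (real N)\<^sup>2)"
    using assms by (intro continuous_intros) auto
  then show ?thesis by (simp add: array_gain_eq_sin_ratio[OF assms, abs_def])
qed

section \<open>Gauss-Chebyshev quadrature\<close>

lemma midpoint_sum_tendsto_integral:
  fixes h :: "real \<Rightarrow> real"
  assumes h: "continuous_on {0..b} h" and b: "b > 0"
  shows "(\<lambda>u. b / real u * (\<Sum>k=1..u. h ((2 * real k - 1) / (2 * real u) * b))) \<longlonglongrightarrow> integral {0..b} h"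
proof (rule LIMSEQ_I)
  fix e :: real assume e: "e > 0"
  \<comment> \<open>Each cell of width d contributes an error of at most \<open>e' * d\<close>, so
    the total is at most \<open>e' * b\<close> = e/2; the factor 2 makes the final inequality
    strict.\<close>
  define e' where "e' = e / (2 * b)"
  have e': "e' > 0" using e b by (simp add: e'_def)
  have "uniformly_continuous_on {0..b} h"
    using h by (rule compact_uniformly_continuous) simp
  then obtain \<delta> where \<delta>: "\<delta> > 0"
    "\<And>x y. x \<in> {0..b} \<Longrightarrow> y \<in> {0..b} \<Longrightarrow> dist x y < \<delta> \<Longrightarrow> dist (h x) (h y) < e'"
    using e' unfolding uniformly_continuous_on_def by metis
  obtain u0 :: nat where u0: "b / \<delta> < real u0" using reals_Archimedean2 by blast
  show "\<exists>no. \<forall>u\<ge>no. norm (b / real u * (\<Sum>k=1..u. h ((2 * real k - 1) / (2 * real u) * b))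
      - integral {0..b} h) < e"
  proof (intro exI allI impI)
    fix u :: nat assume u: "u \<ge> Suc u0"
    define d where "d = b / real u"
    have "b / \<delta> < real u" using u u0 by linarith
    then have "b < real u * \<delta>" using \<delta>(1) by (simp add: field_simps)
    then have d: "d > 0" "d < \<delta>" "real u * d = b"
      using b u by (auto simp: d_def field_simps)
    have upper: "real k * d \<le> b" if "k \<le> u" for k
      using d(3) mult_right_mono[of "real k" "real u" d] that d(1) by simp
    have int: "integral {0..real m * d} h = (\<Sum>k=1..m. integral {(real k - 1) * d..real k * d} h)"
      if "m \<le> u" for m using that
    proof (induction m)
      case (Suc m)
      have "h integrable_on {0..real (Suc m) * d}"
        using upper[OF Suc.prems] by (intro integrable_continuous_real continuous_on_subset[OF h]) auto
      then have "integral {0..real m * d} h + integral {real m * d..real (Suc m) * d} h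
          = integral {0..real (Suc m) * d} h"
        using d(1) by (intro Henstock_Kurzweil_Integration.integral_combine) (auto simp: field_simps)
      then show ?case using Suc by simp
    qed simp
    have cell: "\<bar>d * h ((2 * real k - 1) / (2 * real u) * b) - integral {(real k - 1) * d..real k * d} h\<bar> \<le> e' * d"
      if k: "k \<in> {1..u}" for k
    proof -
      let ?c = "(2 * real k - 1) / (2 * real u) * b"
      have c: "?c = (real k - 1/2) * d"
        using u by (simp add: d_def field_simps)
      have sub: "{(real k - 1) * d..real k * d} \<subseteq> {0..b}"
        using k upper[of k] d(1) by (auto intro: order_trans[OF _ upper[of k]] order_trans[of 0 "(real k - 1) * d"])
      have cc: "?c \<in> {(real k - 1) * d..real k * d}"
        using d(1) unfolding c by auto
      have cont: "continuous_on {(real k - 1) * d..real k * d} h"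
        by (rule continuous_on_subset[OF h sub])
      have "norm (integral {(real k - 1) * d..real k * d} (\<lambda>x. h x - h ?c)) \<le> e' * (real k * d - (real k - 1) * d)"
      proof (rule integral_bound)
        show "(real k - 1) * d \<le> real k * d" using d(1) by simp
        show "continuous_on {(real k - 1) * d..real k * d} (\<lambda>x. h x - h ?c)"
          by (intro continuous_intros cont)
        fix x assume x: "x \<in> {(real k - 1) * d..real k * d}"
        have "\<bar>x - ?c\<bar> \<le> d" using x d(1) unfolding c by (auto simp: abs_le_iff algebra_simps)
        then have "dist x ?c < \<delta>" using d(2) by (simp add: dist_real_def)
        then show "norm (h x - h ?c) \<le> e'"
          using \<delta>(2)[of x ?c] x cc sub by (force simp: dist_real_def)
      qed
      moreover have "integral {(real k - 1) * d..real k * d} (\<lambda>x. h x - h ?c)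
          = integral {(real k - 1) * d..real k * d} h - d * h ?c"
        using d(1) integrable_continuous_real[OF cont]
        by (subst integral_diff) (auto simp: algebra_simps)
      ultimately show ?thesis by (simp add: abs_minus_commute algebra_simps)
    qed
    have "b / real u * (\<Sum>k=1..u. h ((2 * real k - 1) / (2 * real u) * b)) - integral {0..b} h
        = (\<Sum>k=1..u. d * h ((2 * real k - 1) / (2 * real u) * b) - integral {(real k - 1) * d..real k * d} h)"
      using int[of u] d(3) by (simp add: sum_subtractf sum_distrib_left d_def)
    also have "\<bar>\<dots>\<bar> \<le> (\<Sum>k=1..u. e' * d)"
      by (rule order_trans[OF sum_abs sum_mono[OF cell]])
    also have "\<dots> = e' * b" using d(3) by simp
    also have "\<dots> < e" using e b by (simp add: e'_def)
    finally show "norm (b / real u * (\<Sum>k=1..u. h ((2 * real k - 1) / (2 * real u) * b))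
      - integral {0..b} h) < e" by simp
  qed
qed

lemma gauss_chebyshev:
  fixes f :: "real \<Rightarrow> real"
  assumes f: "continuous_on {-1..1} f"
  shows "(\<lambda>u. pi / real u * (\<Sum>k=1..u. f (cheb_node u k) * sqrt (1 - (cheb_node u k)\<^sup>2)))
     \<longlonglongrightarrow> integral {-1..1} f"
proof -
  define h where "h = (\<lambda>\<theta>. f (cos \<theta>) * sin \<theta>)"
  have "continuous_on {0..pi} (\<lambda>\<theta>. f (cos \<theta>))"
    by (rule continuous_on_compose2[OF f]) (auto intro!: continuous_intros)
  then have h: "continuous_on {0..pi} h"
    unfolding h_def by (intro continuous_intros)
  \<comment> \<open>The cosine reverses orientation: the first of the two integrals runs over the
    empty interval from 1 to -1 and vanishes, and the remaining sign is absorbed by the negation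
    that follows.\<close>
  have "((\<lambda>\<theta>. - sin \<theta> *\<^sub>R f (cos \<theta>)) has_integral (integral {cos 0..cos pi} f - integral {cos pi..cos 0} f)) {0..pi}"
  proof (rule has_integral_substitution_general[OF finite.emptyI _ _ f])
    show "cos ` {0..pi} \<subseteq> {-1..1}" by auto
    show "continuous_on {0..pi} (cos :: real \<Rightarrow> real)" by (intro continuous_intros)
    show "(cos has_real_derivative - sin x) (at x within {0..pi})" for x :: real
      by (rule has_field_derivative_at_within[OF DERIV_cos])
  qed simp
  then have "((\<lambda>\<theta>. - (- sin \<theta> *\<^sub>R f (cos \<theta>))) has_integral integral {-1..1} f) {0..pi}"
    by (auto dest: has_integral_neg)
  then have "(h has_integral integral {-1..1} f) {0..pi}"
    by (simp add: h_def mult.commute)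
  then have int: "integral {0..pi} h = integral {-1..1} f" by (rule integral_unique)
  have eq: "pi / real u * (\<Sum>k=1..u. h ((2 * real k - 1) / (2 * real u) * pi))
      = pi / real u * (\<Sum>k=1..u. f (cheb_node u k) * sqrt (1 - (cheb_node u k)\<^sup>2))" for u
  proof -
    have "h ((2 * real k - 1) / (2 * real u) * pi) = f (cheb_node u k) * sqrt (1 - (cheb_node u k)\<^sup>2)"
      if k: "k \<in> {1..u}" for k
    proof -
      let ?t = "(2 * real k - 1) / (2 * real u) * pi"
      have "(2 * real k - 1) / (2 * real u) \<le> 1" "0 \<le> (2 * real k - 1) / (2 * real u)"
        using k by auto
      then have "0 \<le> ?t" "?t \<le> pi"
        using mult_right_mono[of "(2 * real k - 1) / (2 * real u)" 1 pi]
          mult_nonneg_nonneg[of "(2 * real k - 1) / (2 * real u)" pi] by simp_all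
      then have "sin ?t \<ge> 0" by (rule sin_ge_zero)
      moreover have "1 - (cos ?t)\<^sup>2 = (sin ?t)\<^sup>2" by (simp add: sin_squared_eq)
      ultimately have "sqrt (1 - (cos ?t)\<^sup>2) = sin ?t" by simp
      then show ?thesis by (simp add: h_def cheb_node_def)
    qed
    then show ?thesis by simp
  qed
  show ?thesis
    using midpoint_sum_tendsto_integral[OF h pi_gt_zero] by (simp only: eq int)
qed

section \<open>Functionals of marked Poisson processes\<close>

text \<open>The sequence is constant once n exceeds every relevant index. The truncated products
  have an index range that does not depend on the outcome, which is what Fubini and the product rule
  for independent variables require.\<close>

lemma tendsto_prod_enumeration:
  fixes k :: enat and f :: "nat \<Rightarrow> real"
  assumes "finite {i. enat i < k \<and> x i \<in> B}"
  shows "(\<lambda>n. \<Prod>i<n. if enat i < k \<and> x i \<in> B then f i else 1)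
    \<longlonglongrightarrow> (\<Prod>i\<in>{i. enat i < k \<and> x i \<in> B}. f i)"
proof -
  let ?J = "{i. enat i < k \<and> x i \<in> B}"
  obtain n0 where n0: "\<forall>i\<in>?J. i < n0" using assms by (meson finite_nat_set_iff_bounded)
  have "(\<Prod>i<n. if enat i < k \<and> x i \<in> B then f i else 1) = (\<Prod>i\<in>?J. f i)" if "n \<ge> n0" for n
  proof -
    have "?J \<subseteq> {..<n}" using n0 that by fastforce
    then have "?J = {i \<in> {..<n}. enat i < k \<and> x i \<in> B}" by auto
    then show ?thesis by (simp only: prod.inter_filter[OF finite_lessThan])
  qed
  then have "eventually (\<lambda>n. (\<Prod>i<n. if enat i < k \<and> x i \<in> B then f i else 1) = (\<Prod>i\<in>?J. f i)) sequentially"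
    by (auto simp: eventually_sequentially)
  then show ?thesis by (rule tendsto_eventually)
qed

context prob_space
begin

text \<open>Independence of generated sigma-algebras is the product formula on rectangles, and
  rectangles determine a product measure. In this form independence of points and marks can be
  combined with Fubini.\<close>

lemma joint_distr_of_indep_vimage_algebras:
  assumes T[measurable]: "T \<in> measurable M S" and Y[measurable]: "Y \<in> measurable M R"
  assumes indep: "indep_set (sets (vimage_algebra (space M) T S)) (sets (vimage_algebra (space M) Y R))"
  shows "distr M S T \<Otimes>\<^sub>M distr M R Y = distr M (S \<Otimes>\<^sub>M R) (\<lambda>z. (T z, Y z))"
proof (rule pair_measure_eqI)
  interpret T: prob_space "distr M S T" by (rule prob_space_distr) measurable
  interpret Y: prob_space "distr M R Y" by (rule prob_space_distr) measurable
  show "sigma_finite_measure (distr M S T)" "sigma_finite_measure (distr M R Y)" by unfold_locales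
  fix A B assume "A \<in> sets (distr M S T)" "B \<in> sets (distr M R Y)"
  then have A[measurable]: "A \<in> sets S" and B[measurable]: "B \<in> sets R" by simp_all
  have "prob ((T -` A \<inter> space M) \<inter> (Y -` B \<inter> space M)) = prob (T -` A \<inter> space M) * prob (Y -` B \<inter> space M)"
    by (rule indep_setD[OF indep in_vimage_algebra[OF A] in_vimage_algebra[OF B]])
  moreover have "(T -` A \<inter> space M) \<inter> (Y -` B \<inter> space M) = (\<lambda>z. (T z, Y z)) -` (A \<times> B) \<inter> space M"
    by auto
  ultimately show "emeasure (distr M S T) A * emeasure (distr M R Y) B
      = emeasure (distr M (S \<Otimes>\<^sub>M R) (\<lambda>z. (T z, Y z))) (A \<times> B)"
    by (simp add: emeasure_distr emeasure_eq_measure ennreal_mult'')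
qed simp

text \<open>By the product form of the joint law, the enumeration t may be frozen while integrating
  over the marks. For frozen t the factors are functions of distinct independent \<open>Y i\<close>,
  each of law Q, so the expectation of the product factorizes.\<close>

lemma expectation_prod_marks_enumeration:
  fixes \<kappa> :: "'a \<Rightarrow> enat" and X :: "nat \<Rightarrow> 'a \<Rightarrow> 'b::euclidean_space" and Y :: "nat \<Rightarrow> 'a \<Rightarrow> 'm"
    and e :: "'b \<Rightarrow> 'm \<Rightarrow> real"
  assumes Q: "prob_space Q"
    and \<kappa>[measurable]: "\<kappa> \<in> measurable M (count_space UNIV)"
    and X[measurable]: "\<And>i. X i \<in> borel_measurable M"
    and Y[measurable]: "\<And>i. Y i \<in> measurable M Q"
    and law: "\<And>i. distr M Q (Y i) = Q"
    and iid: "indep_vars (\<lambda>_. Q) Y UNIV"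
    and indep: "indep_set
          (sets (vimage_algebra (space M) (\<lambda>z. (\<kappa> z, \<lambda>i. X i z))
                   (count_space UNIV \<Otimes>\<^sub>M PiM UNIV (\<lambda>_. borel))))
          (sets (vimage_algebra (space M) (\<lambda>z i. Y i z) (PiM UNIV (\<lambda>_. Q))))"
    and B[measurable]: "B \<in> sets borel"
    and e[measurable]: "(\<lambda>p. e (fst p) (snd p)) \<in> borel_measurable (borel \<Otimes>\<^sub>M Q)"
    and e0: "\<And>x m. 0 \<le> e x m" and e1: "AE m in Q. \<forall>x. e x m \<le> 1"
  shows "expectation (\<lambda>z. \<Prod>i<n. if enat i < \<kappa> z \<and> X i z \<in> B then e (X i z) (Y i z) else 1)
       = expectation (\<lambda>z. \<Prod>i<n. if enat i < \<kappa> z \<and> X i z \<in> B then \<integral>m. e (X i z) m \<partial>Q else 1)"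
proof -
  interpret Q: prob_space Q by fact
  define S :: "(enat \<times> (nat \<Rightarrow> 'b)) measure" where "S = count_space UNIV \<Otimes>\<^sub>M PiM UNIV (\<lambda>_. borel)"
  define R :: "(nat \<Rightarrow> 'm) measure" where "R = PiM UNIV (\<lambda>_. Q)"
  define T where "T = (\<lambda>z. (\<kappa> z, \<lambda>i. X i z))"
  define V where "V = (\<lambda>z i. Y i z)"
  have T[measurable]: "T \<in> measurable M S"
    unfolding T_def S_def by (intro measurable_Pair measurable_PiM_single') auto
  have V[measurable]: "V \<in> measurable M R"
    unfolding V_def R_def by (intro measurable_PiM_single') (auto intro: measurable_space[OF Y])
  have joint: "distr M S T \<Otimes>\<^sub>M distr M R V = distr M (S \<Otimes>\<^sub>M R) (\<lambda>z. (T z, V z))"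
    using indep by (intro joint_distr_of_indep_vimage_algebras T V) (simp add: S_def R_def T_def V_def)
  interpret DT: prob_space "distr M S T" by (rule prob_space_distr) measurable
  interpret DV: prob_space "distr M R V" by (rule prob_space_distr) measurable
  interpret D: pair_prob_space "distr M S T" "distr M R V" ..
  define F where "F = (\<lambda>i t m. if enat i < fst t \<and> snd t i \<in> B then e (snd t i) m else (1::real))"
  have F[measurable]: "(\<lambda>p. F i (fst p) (snd p)) \<in> borel_measurable (S \<Otimes>\<^sub>M Q)" for i
  proof -
    have [measurable]: "(\<lambda>p. snd (fst p) i) \<in> measurable (S \<Otimes>\<^sub>M Q) borel"
      unfolding S_def by (rule measurable_compose[OF measurable_fst])
        (rule measurable_compose[OF measurable_snd], rule measurable_component_singleton, simp)
    have [measurable]: "(\<lambda>p. fst (fst p)) \<in> measurable (S \<Otimes>\<^sub>M Q) (count_space UNIV)"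
      unfolding S_def by (rule measurable_compose[OF measurable_fst measurable_fst])
    have [measurable]: "(\<lambda>p. e (snd (fst p) i) (snd p)) \<in> borel_measurable (S \<Otimes>\<^sub>M Q)"
      using measurable_compose[OF measurable_Pair[OF \<open>(\<lambda>p. snd (fst p) i) \<in> _\<close> measurable_snd] e] by simp
    show ?thesis unfolding F_def by measurable
  qed
  have Fm: "(\<lambda>p. F i (f p) (g p)) \<in> borel_measurable L"
    if "f \<in> measurable L S" "g \<in> measurable L Q" for f g i and L :: "'z measure"
    using measurable_compose[OF measurable_Pair[OF that] F[of i]] by simp
  have F0: "0 \<le> F i t m" for i t m by (simp add: F_def e0)
  \<comment> \<open>The exceptional null set must not depend on the point, since the points are
    random; hence the quantifier over x inside the almost-everywhere hypothesis. Only the countably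
    many indices i are collected by countable additivity.\<close>
  have F1: "AE z in M. \<forall>i t. F i t (Y i z) \<le> 1"
  proof -
    have "AE z in M. \<forall>x. e x (Y i z) \<le> 1" for i
      using e1 by (subst (asm) law[of i, symmetric]) (rule AE_distrD[OF Y])
    then have "AE z in M. \<forall>i x. e x (Y i z) \<le> 1" by (simp add: AE_all_countable)
    then show ?thesis by eventually_elim (simp add: F_def)
  qed
  have compR: "(\<lambda>y. y i) \<in> measurable R Q" for i
    unfolding R_def by (rule measurable_component_singleton) simp
  have int: "integrable (distr M S T \<Otimes>\<^sub>M distr M R V) (\<lambda>p. \<Prod>i<n. F i (fst p) (snd p i))"
    unfolding joint
  proof (subst integrable_distr_eq)
    show "(\<lambda>p. \<Prod>i<n. F i (fst p) (snd p i)) \<in> borel_measurable (S \<Otimes>\<^sub>M R)"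
      by (intro borel_measurable_prod Fm measurable_fst measurable_compose[OF measurable_snd compR])
    then have "(\<lambda>z. \<Prod>i<n. F i (fst (T z, V z)) (snd (T z, V z) i)) \<in> borel_measurable M"
      by (rule measurable_compose[rotated]) measurable
    then show "integrable M (\<lambda>z. \<Prod>i<n. F i (fst (T z, V z)) (snd (T z, V z) i))"
    proof (rule integrable_const_bound[rotated])
      show "AE z in M. norm (\<Prod>i<n. F i (fst (T z, V z)) (snd (T z, V z) i)) \<le> 1"
        using F1 by eventually_elim (auto simp: V_def F0 abs_prod simp del: split_paired_All intro!: prod_le_1)
    qed
  qed measurable
  have Fi: "integral\<^sup>L Q (F i t) = (if enat i < fst t \<and> snd t i \<in> B then \<integral>m. e (snd t i) m \<partial>Q else 1)" for i t
    by (cases "enat i < fst t \<and> snd t i \<in> B") (auto simp: F_def Q.prob_space)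
  have "expectation (\<lambda>z. \<Prod>i<n. F i (T z) (V z i)) = (\<integral>p. (\<Prod>i<n. F i (fst p) (snd p i)) \<partial>(distr M S T \<Otimes>\<^sub>M distr M R V))"
    unfolding joint
  proof (subst integral_distr)
    show "(\<lambda>p. \<Prod>i<n. F i (fst p) (snd p i)) \<in> borel_measurable (S \<Otimes>\<^sub>M R)"
      by (intro borel_measurable_prod Fm measurable_fst measurable_compose[OF measurable_snd compR])
  qed (rule measurable_Pair[OF T V], simp)
  also have "\<dots> = (\<integral>t. (\<integral>y. (\<Prod>i<n. F i t (y i)) \<partial>distr M R V) \<partial>distr M S T)"
    using D.integral_fst'[OF int] by simp
  also have "\<dots> = (\<integral>t. (\<Prod>i<n. integral\<^sup>L Q (F i t)) \<partial>distr M S T)"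
  proof (rule Bochner_Integration.integral_cong[OF refl])
    fix t assume "t \<in> space (distr M S T)"
    then have t: "t \<in> space S" by simp
    have Ft: "F i t \<in> borel_measurable Q" for i
      using Fm[of "\<lambda>_. t" Q "\<lambda>m. m" i] t by simp
    have "(\<integral>y. (\<Prod>i<n. F i t (y i)) \<partial>distr M R V) = expectation (\<lambda>z. \<Prod>i<n. F i t (Y i z))"
      using t by (subst integral_distr[OF V])
        (auto simp: V_def intro!: borel_measurable_prod measurable_compose[OF compR Ft])
    also have "\<dots> = (\<Prod>i<n. expectation (\<lambda>z. F i t (Y i z)))"
    proof (rule indep_vars_lebesgue_integral)
      show "indep_vars (\<lambda>_. borel) (\<lambda>i z. F i t (Y i z)) {..<n}"
        by (rule indep_vars_compose2[OF indep_vars_subset[OF iid] Ft]) auto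
      show "integrable M (\<lambda>z. F i t (Y i z))" for i
      proof (rule integrable_const_bound)
        show "AE z in M. norm (F i t (Y i z)) \<le> 1"
          using F1 by eventually_elim (simp add: F0 del: split_paired_All)
      qed (rule measurable_compose[OF Y Ft])
    qed simp
    also have "\<dots> = (\<Prod>i<n. integral\<^sup>L Q (F i t))"
    proof (rule prod.cong[OF refl])
      fix i
      show "expectation (\<lambda>z. F i t (Y i z)) = integral\<^sup>L Q (F i t)"
        using integral_distr[OF Y Ft, of i i] by (simp add: law)
    qed
    finally show "(\<integral>y. (\<Prod>i<n. F i t (y i)) \<partial>distr M R V) = (\<Prod>i<n. integral\<^sup>L Q (F i t))" .
  qed
  also have "\<dots> = expectation (\<lambda>z. \<Prod>i<n. integral\<^sup>L Q (F i (T z)))"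
  proof (rule integral_distr[OF T])
    show "(\<lambda>t. \<Prod>i<n. integral\<^sup>L Q (F i t)) \<in> borel_measurable S"
      using F by (intro borel_measurable_prod Q.borel_measurable_lebesgue_integral) (simp add: case_prod_beta')
  qed
  finally show ?thesis
    unfolding Fi unfolding F_def T_def V_def fst_conv snd_conv .
qed

lemma expectation_prod_marks:
  fixes \<Phi> :: "'a \<Rightarrow> 'b::euclidean_space set" and e :: "'b \<Rightarrow> 'm \<Rightarrow> real"
  assumes Q: "prob_space Q" and marked: "independently_marked M Q \<Phi> mk"
    and fin: "\<And>z. z \<in> space M \<Longrightarrow> finite (\<Phi> z \<inter> B)"
    and B: "B \<in> sets borel"
    and e: "(\<lambda>p. e (fst p) (snd p)) \<in> borel_measurable (borel \<Otimes>\<^sub>M Q)"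
    and e0: "\<And>x m. 0 \<le> e x m" and e1: "AE m in Q. \<forall>x. e x m \<le> 1"
  shows "expectation (\<lambda>z. \<Prod>x\<in>\<Phi> z \<inter> B. e x (mk z x)) = expectation (\<lambda>z. \<Prod>x\<in>\<Phi> z \<inter> B. \<integral>m. e x m \<partial>Q)"
proof -
  interpret Q: prob_space Q by fact
  obtain \<kappa> X Y where
    \<kappa>[measurable]: "\<kappa> \<in> measurable M (count_space UNIV)"
    and X[measurable]: "\<And>i. X i \<in> borel_measurable M"
    and Y[measurable]: "\<And>i. Y i \<in> measurable M Q"
    and bij: "\<And>z. z \<in> space M \<Longrightarrow> bij_betw (\<lambda>i. X i z) {i. enat i < \<kappa> z} (\<Phi> z)"
    and mk: "\<And>z i. z \<in> space M \<Longrightarrow> enat i < \<kappa> z \<Longrightarrow> mk z (X i z) = Y i z"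
    and law: "\<And>i. distr M Q (Y i) = Q"
    and iid: "indep_vars (\<lambda>_. Q) Y UNIV"
    and indep: "indep_set
          (sets (vimage_algebra (space M) (\<lambda>z. (\<kappa> z, \<lambda>i. X i z))
                   (count_space UNIV \<Otimes>\<^sub>M PiM UNIV (\<lambda>_. borel))))
          (sets (vimage_algebra (space M) (\<lambda>z i. Y i z) (PiM UNIV (\<lambda>_. Q))))"
    using marked unfolding independently_marked_def by blast
  define g where "g = (\<lambda>x. \<integral>m. e x m \<partial>Q)"
  have g[measurable]: "g \<in> borel_measurable borel"
    unfolding g_def using e by (intro Q.borel_measurable_lebesgue_integral) (simp add: case_prod_beta')
  have g0: "0 \<le> g x" for x unfolding g_def by (rule Bochner_Integration.integral_nonneg) (rule e0)
  have g1: "g x \<le> 1" for x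
  proof -
    have "g x \<le> (\<integral>m. 1 \<partial>Q)"
      unfolding g_def using e1 by (intro integral_mono_AE') (auto simp: e0 elim: eventually_mono)
    then show ?thesis by (simp add: Q.prob_space)
  qed
  define J where "J = (\<lambda>z. {i. enat i < \<kappa> z \<and> X i z \<in> B})"
  have bijJ: "bij_betw (\<lambda>i. X i z) (J z) (\<Phi> z \<inter> B)" if "z \<in> space M" for z
    using bij[OF that] unfolding J_def bij_betw_def inj_on_def by auto
  have finJ: "finite (J z)" if "z \<in> space M" for z
    using bij_betw_finite[OF bijJ[OF that]] fin[OF that] by simp
  define P where "P = (\<lambda>f n z. \<Prod>i<n. if enat i < \<kappa> z \<and> X i z \<in> B then f i z else (1::real))"
  have lim: "(\<lambda>n. P f n z) \<longlonglongrightarrow> (\<Prod>i\<in>J z. f i z)" if "z \<in> space M" for f z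
    unfolding P_def J_def using finJ[OF that] by (intro tendsto_prod_enumeration) (simp add: J_def)
  have Pm: "P f n \<in> borel_measurable M" if [measurable]: "\<And>i. f i \<in> borel_measurable M" for f n
    unfolding P_def using B by measurable
  \<comment> \<open>Applied both to the marked factors and to their averages g: for every n the
    truncated expectations agree, so the two limits do.\<close>
  have conv: "(\<lambda>n. expectation (P f n)) \<longlonglongrightarrow> expectation (\<lambda>z. \<Prod>i\<in>J z. f i z)"
    if f: "\<And>i. f i \<in> borel_measurable M" and f0: "\<And>i z. 0 \<le> f i z" and f1: "AE z in M. \<forall>i. f i z \<le> 1" for f
  proof (rule integral_dominated_convergence[where w = "\<lambda>_. 1"])
    show "(\<lambda>z. \<Prod>i\<in>J z. f i z) \<in> borel_measurable M"
      by (rule borel_measurable_LIMSEQ_real[OF lim Pm[OF f]])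
    show "AE z in M. (\<lambda>n. P f n z) \<longlonglongrightarrow> (\<Prod>i\<in>J z. f i z)"
      using lim by (intro AE_I2)
    show "AE z in M. norm (P f n z) \<le> 1" for n
      using f1 by eventually_elim (auto simp: P_def abs_prod f0 intro!: prod_le_1)
  qed (use Pm[OF f] in simp_all)
  have "AE z in M. \<forall>x. e x (Y i z) \<le> 1" for i
    using e1 by (subst (asm) law[of i, symmetric]) (rule AE_distrD[OF Y])
  then have "AE z in M. \<forall>i x. e x (Y i z) \<le> 1" by (simp add: AE_all_countable)
  then have "AE z in M. \<forall>i. e (X i z) (Y i z) \<le> 1" by eventually_elim simp
  moreover have "(\<lambda>z. e (X i z) (Y i z)) \<in> borel_measurable M" for i
    using measurable_compose[OF measurable_Pair[OF X Y] e] by simp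
  ultimately have "(\<lambda>n. expectation (P (\<lambda>i z. e (X i z) (Y i z)) n)) \<longlonglongrightarrow> expectation (\<lambda>z. \<Prod>i\<in>J z. e (X i z) (Y i z))"
    by (intro conv e0)
  moreover have "expectation (P (\<lambda>i z. e (X i z) (Y i z)) n) = expectation (P (\<lambda>i z. g (X i z)) n)" for n
    unfolding P_def g_def by (rule expectation_prod_marks_enumeration[OF Q \<kappa> X Y law iid indep B e e0 e1])
  ultimately have "(\<lambda>n. expectation (P (\<lambda>i z. g (X i z)) n)) \<longlonglongrightarrow> expectation (\<lambda>z. \<Prod>i\<in>J z. e (X i z) (Y i z))"
    by simp
  moreover have "(\<lambda>n. expectation (P (\<lambda>i z. g (X i z)) n)) \<longlonglongrightarrow> expectation (\<lambda>z. \<Prod>i\<in>J z. g (X i z))"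
    using g0 g1 by (intro conv) auto
  ultimately have "expectation (\<lambda>z. \<Prod>i\<in>J z. e (X i z) (Y i z)) = expectation (\<lambda>z. \<Prod>i\<in>J z. g (X i z))"
    by (rule LIMSEQ_unique)
  moreover have "(\<Prod>x\<in>\<Phi> z \<inter> B. e x (mk z x)) = (\<Prod>i\<in>J z. e (X i z) (Y i z))" if "z \<in> space M" for z
    using mk[OF that] by (subst prod.reindex_bij_betw[OF bijJ[OF that], symmetric]) (auto simp: J_def intro!: prod.cong)
  moreover have "(\<Prod>x\<in>\<Phi> z \<inter> B. g x) = (\<Prod>i\<in>J z. g (X i z))" if "z \<in> space M" for z
    by (subst prod.reindex_bij_betw[OF bijJ[OF that], symmetric]) simp
  ultimately show ?thesis
    unfolding g_def by (simp cong: Bochner_Integration.integral_cong)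
qed

end

section \<open>The probability generating functional of the Poisson process\<close>

lemma homogeneous_pppD:
  assumes "homogeneous_ppp M l A \<Phi>"
  shows homogeneous_ppp_subset: "z \<in> space M \<Longrightarrow> \<Phi> z \<subseteq> A"
    and homogeneous_ppp_finite: "z \<in> space M \<Longrightarrow> bounded B \<Longrightarrow> finite (\<Phi> z \<inter> B)"
    and homogeneous_ppp_measurable: "B \<in> sets borel \<Longrightarrow> bounded B \<Longrightarrow> B \<subseteq> A \<Longrightarrow>
        (\<lambda>z. card (\<Phi> z \<inter> B)) \<in> measurable M (count_space UNIV)"
    and homogeneous_ppp_law: "B \<in> sets borel \<Longrightarrow> bounded B \<Longrightarrow> B \<subseteq> A \<Longrightarrow>
        measure M {z \<in> space M. card (\<Phi> z \<inter> B) = k} =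
             (l * measure lborel B) ^ k / fact k * exp (- (l * measure lborel B))"
    and homogeneous_ppp_indep: "finite (I::nat set) \<Longrightarrow>
        (\<And>i. i \<in> I \<Longrightarrow> C i \<in> sets borel \<and> bounded (C i) \<and> C i \<subseteq> A) \<Longrightarrow> disjoint_family_on C I \<Longrightarrow>
        prob_space.indep_vars M (\<lambda>_. count_space UNIV) (\<lambda>i z. card (\<Phi> z \<inter> C i)) I"
  using assms unfolding homogeneous_ppp_def by simp_all

context prob_space
begin

lemma expectation_power_Poisson:
  fixes N :: "'a \<Rightarrow> nat" and \<mu> c :: real
  assumes N[measurable]: "N \<in> measurable M (count_space UNIV)"
    and law: "\<And>k. prob {z \<in> space M. N z = k} = \<mu> ^ k / fact k * exp (- \<mu>)"
    and \<mu>: "0 \<le> \<mu>" and c: "0 \<le> c"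
  shows "expectation (\<lambda>z. c ^ N z) = exp (- (\<mu> * (1 - c)))"
proof -
  define p where "p = (\<lambda>k::nat. \<mu> ^ k / fact k * exp (- \<mu>))"
  have p0: "p k \<ge> 0" for k using \<mu> by (simp add: p_def)
  have distr: "distr M (count_space UNIV) N = density (count_space UNIV) (\<lambda>k. ennreal (p k))"
  proof (rule measure_eqI_countable)
    fix k :: nat
    have "N -` {k} \<inter> space M = {z \<in> space M. N z = k}" by auto
    then have "emeasure (distr M (count_space UNIV) N) {k} = ennreal (p k)"
      by (simp add: emeasure_distr emeasure_eq_measure law p_def)
    then show "emeasure (distr M (count_space UNIV) N) {k}
        = emeasure (density (count_space UNIV) (\<lambda>k. ennreal (p k))) {k}"
      by (simp add: emeasure_density)
  qed auto
  have sums: "(\<lambda>k. p k * c ^ k) sums exp (- (\<mu> * (1 - c)))"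
  proof -
    have "(\<lambda>k. exp (- \<mu>) * ((\<mu> * c) ^ k /\<^sub>R fact k)) sums (exp (- \<mu>) * exp (\<mu> * c))"
      by (intro sums_mult exp_converges)
    moreover have "exp (- \<mu>) * ((\<mu> * c) ^ k /\<^sub>R fact k) = p k * c ^ k" for k
      by (simp add: p_def power_mult_distrib divide_inverse)
    moreover have "exp (- \<mu>) * exp (\<mu> * c) = exp (- (\<mu> * (1 - c)))"
      by (simp add: mult_exp_exp right_diff_distrib)
    ultimately show ?thesis by simp
  qed
  have "expectation (\<lambda>z. c ^ N z) = (\<integral>k. c ^ k \<partial>distr M (count_space UNIV) N)"
    by (simp add: integral_distr)
  also have "\<dots> = (\<integral>k. p k * c ^ k \<partial>count_space UNIV)"
    unfolding distr by (subst integral_density) (auto simp: p0)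
  also have "\<dots> = (\<Sum>k. p k * c ^ k)"
  proof (rule integral_count_space_nat)
    show "integrable (count_space UNIV) (\<lambda>k. p k * c ^ k)"
      using sums_summable[OF sums] c by (simp add: integrable_count_space_nat_iff p0)
  qed
  also have "\<dots> = exp (- (\<mu> * (1 - c)))"
    using sums by (rule sums_unique[symmetric])
  finally show ?thesis .
qed

lemma homogeneous_ppp_expectation_prod_power:
  fixes \<Phi> :: "'a \<Rightarrow> 'b::euclidean_space set" and B :: "nat \<Rightarrow> 'b set"
  assumes ppp: "homogeneous_ppp M l A \<Phi>" and l: "0 \<le> l" and I: "finite I"
    and B: "\<And>i. i \<in> I \<Longrightarrow> B i \<in> sets borel" "\<And>i. i \<in> I \<Longrightarrow> bounded (B i)" "\<And>i. i \<in> I \<Longrightarrow> B i \<subseteq> A"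
    and disj: "disjoint_family_on B I"
    and c: "\<And>i. i \<in> I \<Longrightarrow> 0 \<le> c i" "\<And>i. i \<in> I \<Longrightarrow> c i \<le> (1::real)"
  shows "expectation (\<lambda>z. \<Prod>i\<in>I. c i ^ card (\<Phi> z \<inter> B i)) = exp (- (l * (\<Sum>i\<in>I. measure lborel (B i) * (1 - c i))))"
proof -
  note meas = homogeneous_ppp_measurable[OF ppp B]
  note law = homogeneous_ppp_law[OF ppp B]
  have indep: "indep_vars (\<lambda>_. count_space UNIV) (\<lambda>i z. card (\<Phi> z \<inter> B i)) I"
    using B by (intro homogeneous_ppp_indep[OF ppp I _ disj]) auto
  have "expectation (\<lambda>z. \<Prod>i\<in>I. c i ^ card (\<Phi> z \<inter> B i)) = (\<Prod>i\<in>I. expectation (\<lambda>z. c i ^ card (\<Phi> z \<inter> B i)))"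
  proof (rule indep_vars_lebesgue_integral[OF I])
    show "indep_vars (\<lambda>_. borel) (\<lambda>i z. c i ^ card (\<Phi> z \<inter> B i)) I"
      by (rule indep_vars_compose2[OF indep, where Y = "\<lambda>i k. c i ^ k"]) simp
    fix i assume i: "i \<in> I"
    show "integrable M (\<lambda>z. c i ^ card (\<Phi> z \<inter> B i))"
    proof (rule integrable_const_bound[where B = 1])
      show "AE z in M. norm (c i ^ card (\<Phi> z \<inter> B i)) \<le> 1"
        using c[OF i] by (auto simp: power_le_one)
      show "(\<lambda>z. c i ^ card (\<Phi> z \<inter> B i)) \<in> borel_measurable M"
        by (rule measurable_compose[OF meas[OF i i i]]) simp
    qed
  qed
  also have "\<dots> = (\<Prod>i\<in>I. exp (- (l * measure lborel (B i) * (1 - c i))))"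
    by (intro prod.cong refl expectation_power_Poisson meas law mult_nonneg_nonneg l c) auto
  also have "\<dots> = exp (\<Sum>i\<in>I. - (l * measure lborel (B i) * (1 - c i)))"
    using I by (rule exp_sum[symmetric])
  finally show ?thesis by (simp add: sum_distrib_left sum_negf mult.assoc)
qed

text \<open>Rounding g down to multiples of 1/(m + 1) splits B into finitely many Borel level sets,
  on which the product is a product of powers of independent Poisson counts. Both sides pass to the
  limit by dominated convergence, with bound 1 on the probability space and the indicator of B, of
  finite measure, on the space of points.\<close>

lemma homogeneous_ppp_expectation_prod:
  fixes \<Phi> :: "'a \<Rightarrow> 'b::euclidean_space set" and g :: "'b \<Rightarrow> real"
  assumes ppp: "homogeneous_ppp M l A \<Phi>" and l: "0 \<le> l"
    and B[measurable]: "B \<in> sets borel" and bB: "bounded B" and BA: "B \<subseteq> A"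
    and g[measurable]: "g \<in> borel_measurable borel" and g0: "\<And>x. 0 \<le> g x" and g1: "\<And>x. g x \<le> 1"
  shows "expectation (\<lambda>z. \<Prod>x\<in>\<Phi> z \<inter> B. g x) = exp (- (l * (\<integral>x. indicator B x * (1 - g x) \<partial>lborel)))"
proof -
  have finB: "emeasure lborel B < \<infinity>" using bB by (rule emeasure_bounded_finite)
  have fin: "finite (\<Phi> z \<inter> B)" if "z \<in> space M" for z
    using that bB by (rule homogeneous_ppp_finite[OF ppp])
  \<comment> \<open>The level of x. As g is at most 1, the levels run from 0 to \<open>Suc m\<close>
    inclusive, hence the index set \<open>{..Suc m}\<close> below.\<close>
  define key where "key = (\<lambda>m x. nat \<lfloor>real (Suc m) * g x\<rfloor>)"
  define gm where "gm = (\<lambda>m x. real (key m x) / real (Suc m))"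
  have key[measurable]: "key m \<in> measurable borel (count_space UNIV)" for m
    unfolding key_def by measurable
  have gm[measurable]: "gm m \<in> borel_measurable borel" for m unfolding gm_def by measurable
  have key_eq: "real (key m x) = of_int \<lfloor>real (Suc m) * g x\<rfloor>" for m x
    using g0[of x] by (simp add: key_def)
  have key_le: "key m x \<le> Suc m" for m x
  proof -
    have "real (Suc m) * g x \<le> real (Suc m)" using mult_left_mono[OF g1[of x], of "real (Suc m)"] by (simp del: of_nat_Suc)
    then have "real (key m x) \<le> real (Suc m)" unfolding key_eq by linarith
    then show ?thesis by simp
  qed
  have gm0: "0 \<le> gm m x" for m x by (simp add: gm_def)
  have gm1: "gm m x \<le> 1" for m x using key_le[of m x] by (simp add: gm_def del: of_nat_Suc)
  have gm_lim: "(\<lambda>m. gm m x) \<longlonglongrightarrow> g x" for x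
  proof (rule tendsto_sandwich)
    show "eventually (\<lambda>m. g x - 1 / real (Suc m) \<le> gm m x) sequentially"
    proof (rule always_eventually, rule allI)
      fix m
      have "real (Suc m) * g x - 1 \<le> real (key m x)" unfolding key_eq by linarith
      then have "(real (Suc m) * g x - 1) / real (Suc m) \<le> gm m x"
        unfolding gm_def by (rule divide_right_mono) simp
      then show "g x - 1 / real (Suc m) \<le> gm m x" by (simp add: diff_divide_distrib del: of_nat_Suc)
    qed
    show "eventually (\<lambda>m. gm m x \<le> g x) sequentially"
    proof (rule always_eventually, rule allI)
      fix m
      have "real (key m x) \<le> real (Suc m) * g x" unfolding key_eq by linarith
      then have "gm m x \<le> real (Suc m) * g x / real (Suc m)"
        unfolding gm_def by (rule divide_right_mono) simp
      then show "gm m x \<le> g x" by (simp del: of_nat_Suc)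
    qed
    show "(\<lambda>m. g x - 1 / real (Suc m)) \<longlonglongrightarrow> g x"
      using tendsto_diff[OF tendsto_const LIMSEQ_inverse_real_of_nat, of "g x"]
      by (simp add: inverse_eq_divide)
  qed simp
  have split: "(\<Prod>x\<in>\<Phi> z \<inter> B. gm m x) = (\<Prod>k\<in>{..Suc m}. (real k / real (Suc m)) ^ card (\<Phi> z \<inter> (B \<inter> key m -` {k})))"
    if z: "z \<in> space M" for m z
  proof -
    have "(\<Prod>x\<in>\<Phi> z \<inter> B. gm m x) = (\<Prod>k\<in>{..Suc m}. \<Prod>x\<in>{x \<in> \<Phi> z \<inter> B. key m x = k}. gm m x)"
      using key_le by (intro prod.group[symmetric] fin[OF z]) auto
    also have "\<dots> = (\<Prod>k\<in>{..Suc m}. (real k / real (Suc m)) ^ card (\<Phi> z \<inter> (B \<inter> key m -` {k})))"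
    proof (rule prod.cong[OF refl])
      fix k
      have "{x \<in> \<Phi> z \<inter> B. key m x = k} = \<Phi> z \<inter> (B \<inter> key m -` {k})" by auto
      moreover have "(\<Prod>x\<in>{x \<in> \<Phi> z \<inter> B. key m x = k}. gm m x) = (\<Prod>x\<in>{x \<in> \<Phi> z \<inter> B. key m x = k}. real k / real (Suc m))"
        by (intro prod.cong) (auto simp: gm_def)
      ultimately show "(\<Prod>x\<in>{x \<in> \<Phi> z \<inter> B. key m x = k}. gm m x) = (real k / real (Suc m)) ^ card (\<Phi> z \<inter> (B \<inter> key m -` {k}))"
        by simp
    qed
    finally show ?thesis .
  qed
  have Bk[measurable]: "B \<inter> key m -` {k} \<in> sets borel" for m k
    using measurable_sets[OF key[of m], of "{k}"] by simp
  have step: "expectation (\<lambda>z. \<Prod>x\<in>\<Phi> z \<inter> B. gm m x) = exp (- (l * (\<integral>x. indicator B x * (1 - gm m x) \<partial>lborel)))" for m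
  proof -
    have "expectation (\<lambda>z. \<Prod>x\<in>\<Phi> z \<inter> B. gm m x)
        = expectation (\<lambda>z. \<Prod>k\<in>{..Suc m}. (real k / real (Suc m)) ^ card (\<Phi> z \<inter> (B \<inter> key m -` {k})))"
      by (rule Bochner_Integration.integral_cong[OF refl split])
    also have "\<dots> = exp (- (l * (\<Sum>k\<in>{..Suc m}. measure lborel (B \<inter> key m -` {k}) * (1 - real k / real (Suc m)))))"
      using bB BA by (intro homogeneous_ppp_expectation_prod_power[OF ppp l])
        (auto simp: disjoint_family_on_def intro: bounded_subset simp del: of_nat_Suc)
    also have "(\<Sum>k\<in>{..Suc m}. measure lborel (B \<inter> key m -` {k}) * (1 - real k / real (Suc m)))
        = (\<integral>x. (\<Sum>k\<in>{..Suc m}. indicator (B \<inter> key m -` {k}) x * (1 - real k / real (Suc m))) \<partial>lborel)"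
    proof (subst Bochner_Integration.integral_sum)
      show "integrable lborel (\<lambda>x. indicator (B \<inter> key m -` {k}) x * (1 - real k / real (Suc m)))" for k
        by (intro integrable_mult_left integrable_real_indicator)
          (use finB emeasure_mono[of "B \<inter> key m -` {k}" B lborel] in \<open>auto intro: le_less_trans\<close>)
    qed simp
    also have "\<dots> = (\<integral>x. indicator B x * (1 - gm m x) \<partial>lborel)"
    proof (rule Bochner_Integration.integral_cong[OF refl])
      fix x
      have "(\<Sum>k\<in>{..Suc m}. indicator (B \<inter> key m -` {k}) x * (1 - real k / real (Suc m)))
          = (\<Sum>k\<in>{..Suc m}. if k = key m x then indicator B x * (1 - gm m x) else 0)"
        by (intro sum.cong) (auto simp: gm_def indicator_def)
      also have "\<dots> = indicator B x * (1 - gm m x)" using key_le[of m x] by simp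
      finally show "(\<Sum>k\<in>{..Suc m}. indicator (B \<inter> key m -` {k}) x * (1 - real k / real (Suc m)))
          = indicator B x * (1 - gm m x)" .
    qed
    finally show ?thesis .
  qed
  \<comment> \<open>Measurability is available only through the counts, so the product over points
    is first rewritten by \<open>split\<close>.\<close>
  have meas: "(\<lambda>z. \<Prod>x\<in>\<Phi> z \<inter> B. gm m x) \<in> borel_measurable M" for m
  proof -
    have "(\<lambda>z. \<Prod>k\<in>{..Suc m}. (real k / real (Suc m)) ^ card (\<Phi> z \<inter> (B \<inter> key m -` {k}))) \<in> borel_measurable M"
    proof (rule borel_measurable_prod)
      fix k
      have "(\<lambda>z. card (\<Phi> z \<inter> (B \<inter> key m -` {k}))) \<in> measurable M (count_space UNIV)"
        using BA by (intro homogeneous_ppp_measurable[OF ppp Bk bounded_subset[OF bB]]) auto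
      then show "(\<lambda>z. (real k / real (Suc m)) ^ card (\<Phi> z \<inter> (B \<inter> key m -` {k}))) \<in> borel_measurable M"
        by (rule measurable_compose) simp
    qed
    then show ?thesis by (subst measurable_cong[OF split])
  qed
  have lim: "(\<lambda>m. \<Prod>x\<in>\<Phi> z \<inter> B. gm m x) \<longlonglongrightarrow> (\<Prod>x\<in>\<Phi> z \<inter> B. g x)" for z
    by (intro tendsto_prod gm_lim)
  have "(\<lambda>m. expectation (\<lambda>z. \<Prod>x\<in>\<Phi> z \<inter> B. gm m x)) \<longlonglongrightarrow> expectation (\<lambda>z. \<Prod>x\<in>\<Phi> z \<inter> B. g x)"
  proof (rule integral_dominated_convergence[where w = "\<lambda>_. 1"])
    show "(\<lambda>z. \<Prod>x\<in>\<Phi> z \<inter> B. g x) \<in> borel_measurable M"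
      by (rule borel_measurable_LIMSEQ_real[OF lim meas])
    show "AE z in M. norm (\<Prod>x\<in>\<Phi> z \<inter> B. gm m x) \<le> 1" for m
      by (auto simp: abs_prod gm0 gm1 intro!: prod_le_1)
  qed (use meas lim in simp_all)
  moreover have "(\<lambda>m. \<integral>x. indicator B x * (1 - gm m x) \<partial>lborel) \<longlonglongrightarrow> (\<integral>x. indicator B x * (1 - g x) \<partial>lborel)"
  proof (rule integral_dominated_convergence[where w = "indicator B"])
    show "integrable lborel (indicator B :: 'b \<Rightarrow> real)"
      using finB by (intro integrable_real_indicator) auto
    show "AE x in lborel. (\<lambda>m. indicator B x * (1 - gm m x)) \<longlonglongrightarrow> indicator B x * (1 - g x)"
      by (intro AE_I2 tendsto_intros gm_lim)
    show "AE x in lborel. norm (indicator B x * (1 - gm m x)) \<le> indicator B x" for m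
      using gm0 gm1 by (intro AE_I2) (auto simp: indicator_def)
  qed measurable
  then have "(\<lambda>m. exp (- (l * (\<integral>x. indicator B x * (1 - gm m x) \<partial>lborel))))
      \<longlonglongrightarrow> exp (- (l * (\<integral>x. indicator B x * (1 - g x) \<partial>lborel)))"
    by (intro tendsto_intros)
  ultimately show ?thesis
    unfolding step by (rule LIMSEQ_unique)
qed

end

section \<open>The interference\<close>

text \<open>Multiplying the Gamma density of rate K by exp(-\<theta> h) gives the Gamma density of
  rate K + \<theta> times (K / (K + \<theta>))^K, and the tilted density has total mass 1.\<close>

lemma fading_law_laplace:
  assumes K: "K \<ge> 1" and \<theta>: "\<theta> \<ge> 0"
  shows "(\<integral>h. exp (- (\<theta> * h)) \<partial>fading_law K) = inverse ((1 + \<theta> / real K) ^ K)"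
proof -
  obtain k where k: "K = Suc k" using K by (cases K) auto
  have pos: "0 < real K + \<theta>" using K \<theta> by simp
  interpret E: prob_space "density lborel (\<lambda>x. ennreal (erlang_density k (real K + \<theta>) x))"
    by (rule prob_space_erlang_density[OF pos])
  have "(\<integral>x. 1 \<partial>density lborel (\<lambda>x. ennreal (erlang_density k (real K + \<theta>) x))) = (1::real)"
    using E.prob_space by simp
  then have one: "(\<integral>x. erlang_density k (real K + \<theta>) x \<partial>lborel) = 1"
    using pos by (subst (asm) integral_density) auto
  have "(\<integral>h. exp (- (\<theta> * h)) \<partial>fading_law K) = (\<integral>x. erlang_density k (real K) x * exp (- (\<theta> * x)) \<partial>lborel)"
    unfolding fading_law_def by (subst integral_density) (auto simp: k)
  also have "\<dots> = (\<integral>x. (real K / (real K + \<theta>)) ^ K * erlang_density k (real K + \<theta>) x \<partial>lborel)"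
  proof (rule Bochner_Integration.integral_cong[OF refl])
    fix x
    have "exp (- (real K * x)) * exp (- (\<theta> * x)) = exp (- ((real K + \<theta>) * x))"
      by (simp add: mult_exp_exp ring_distribs)
    then show "erlang_density k (real K) x * exp (- (\<theta> * x)) = (real K / (real K + \<theta>)) ^ K * erlang_density k (real K + \<theta>) x"
      using pos by (simp add: erlang_density_def power_divide k[symmetric] del: power_Suc)
        (auto simp: algebra_simps)
  qed
  also have "\<dots> = (real K / (real K + \<theta>)) ^ K" by (simp add: one)
  also have "\<dots> = inverse ((1 + \<theta> / real K) ^ K)"
  proof -
    have "real K / (real K + \<theta>) = inverse (1 + \<theta> / real K)" using K pos by (simp add: field_simps)
    then show ?thesis by (simp add: power_inverse)
  qed
  finally show ?thesis .
qed

lemma prob_space_fading_law: "K \<ge> 1 \<Longrightarrow> prob_space (fading_law K)"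
  unfolding fading_law_def by (rule prob_space_erlang_density) simp

lemma AE_fading_law_nonneg:
  assumes "K \<ge> 1"
  shows "AE h in fading_law K. 0 \<le> h"
  unfolding fading_law_def by (subst AE_density) (auto simp: erlang_density_def)

lemma prob_space_angle_law:
  assumes "d > 0" "lam > 0"
  shows "prob_space (angle_law d lam)"
  unfolding angle_law_def using assms by (intro prob_space_uniform_measure) auto

lemma sets_angle_law [measurable_cong]: "sets (angle_law d lam) = sets borel"
  by (simp add: angle_law_def)

lemma sets_fading_law [measurable_cong]: "sets (fading_law K) = sets borel"
  by (simp add: fading_law_def)

lemma angle_law_integral:
  fixes f :: "real \<Rightarrow> real"
  assumes d: "d > 0" "lam > 0" and f: "continuous_on UNIV f"
  shows "(\<integral>w. f w \<partial>angle_law d lam) = integral {-1..1} (\<lambda>x. f (x * d / lam)) / 2"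
proof -
  define D where "D = d / lam"
  have D: "D > 0" using d by (simp add: D_def)
  have [measurable]: "f \<in> borel_measurable borel" by (rule borel_measurable_continuous_onI[OF f])
  have cont: "continuous_on A f" for A using f by (rule continuous_on_subset) simp
  have "(\<integral>w. f w \<partial>angle_law d lam) = (\<integral>w. (indicator {-D..D} w / (2 * D)) * f w \<partial>lborel)"
  proof -
    have "angle_law d lam = density lborel (\<lambda>w. ennreal (indicator {-D..D} w / (2 * D)))"
      unfolding angle_law_def uniform_measure_def D_def[symmetric]
    proof (rule density_cong)
      have "indicator {-D..D} w / ennreal (2 * D) = ennreal (indicator {-D..D} w / (2 * D))" for w
        using D by (auto simp: indicator_def divide_ennreal simp flip: ennreal_1)
      then show "AE w in lborel. indicator {-D..D} w / emeasure lborel {-D..D} = ennreal (indicator {-D..D} w / (2 * D))"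
        using D by simp
    qed measurable
    then show ?thesis using D by (simp add: integral_density)
  qed
  also have "\<dots> = (\<integral>w. indicator {-D..D} w *\<^sub>R f w \<partial>lborel) / (2 * D)"
    by simp
  also have "(\<integral>w. indicator {-D..D} w *\<^sub>R f w \<partial>lborel) = integral {-D..D} f"
    using borel_integrable_atLeastAtMost'[OF cont, of "-D" D]
    by (intro set_borel_integral_eq_integral(2)[unfolded set_lebesgue_integral_def])
  \<comment> \<open>The Jacobian D cancels against the uniform density 1/(2 D), which leaves the
    factor 1/2 of the statement.\<close>
  also have "integral {-D..D} f = D * integral {-1..1} (\<lambda>x. f (x * d / lam))"
  proof -
    have "((\<lambda>x. D *\<^sub>R f (D * x)) has_integral integral {D * (-1)..D * 1} f) {-1..1}"
    proof (rule has_integral_substitution[where c = "-D" and d = D])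
      show "(\<lambda>x. D * x) ` {-1..1} \<subseteq> {-D..D}"
        using D mult_left_mono[of _ 1 D] mult_left_mono[of "-1" _ D] by auto
      show "((\<lambda>x. D * x) has_real_derivative D) (at x within {-1..1})" for x
        by (rule has_field_derivative_at_within[OF DERIV_cmult_Id])
    qed (use D cont in auto)
    from integral_unique[OF this, symmetric] show ?thesis by (simp add: D_def mult.commute)
  qed
  finally show ?thesis using D by simp
qed

section \<open>From the plane to the squared distance\<close>

lemma emeasure_lborel_cdisk: "R \<ge> 0 \<Longrightarrow> emeasure lborel (cball (0::real^2) R) = ennreal (pi * R\<^sup>2)"
  by (simp add: emeasure_cball unit_ball_vol_2)

lemma emeasure_lborel_disk: "R \<ge> 0 \<Longrightarrow> emeasure lborel (ball (0::real^2) R) = ennreal (pi * R\<^sup>2)"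
  by (simp add: emeasure_ball unit_ball_vol_2)

text \<open>Instead of polar coordinates, two measures on the line are compared on open upper
  half-lines: the image of planar Lebesgue measure on the annulus under the squared norm, and \<pi>
  times Lebesgue measure on the interval. Only the area of a disk is needed.\<close>

lemma annulus_integral:
  fixes f :: "real \<Rightarrow> real"
  assumes r: "0 < r" "r < R" and f[measurable]: "f \<in> borel_measurable borel"
  shows "(\<integral>x. indicator {x :: real^2. r < norm x \<and> norm x < R} x * f ((norm x)\<^sup>2) \<partial>lborel)
       = pi * (\<integral>t. indicator {r\<^sup>2<..<R\<^sup>2} t * f t \<partial>lborel)"
proof -
  define A where "A = {x :: real^2. r < norm x \<and> norm x < R}"
  have A[measurable]: "A \<in> sets borel" unfolding A_def by measurable
  define M1 where "M1 = distr (density lborel (\<lambda>x. ennreal (indicator A x))) borel (\<lambda>x :: real^2. (norm x)\<^sup>2)"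
  define M2 where "M2 = density lborel (\<lambda>t. ennreal (pi * indicator {r\<^sup>2<..<R\<^sup>2} t))"
  have sq: "a\<^sup>2 < b\<^sup>2 \<longleftrightarrow> a < b" if "0 \<le> a" "0 \<le> b" for a b :: real
    using that by (simp add: power_mono_iff flip: not_le)
  have M1: "emeasure M1 {y<..} = ennreal (pi * max 0 (R\<^sup>2 - max y (r\<^sup>2)))" for y
  proof -
    \<comment> \<open>The radius beyond which both y < norm(x)^2 and r < norm(x) hold. The maximum
      also covers every y below the squared inner radius, negative ones included.\<close>
    define q where "q = sqrt (max y (r\<^sup>2))"
    have q0: "0 \<le> q" and q2: "q\<^sup>2 = max y (r\<^sup>2)"
      using r by (auto simp: q_def max_def intro: order_trans[of 0 "r\<^sup>2"])
    have lt: "q < norm x \<longleftrightarrow> y < (norm x)\<^sup>2 \<and> r < norm x" for x :: "real^2"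
    proof -
      have "q < norm x \<longleftrightarrow> max y (r\<^sup>2) < (norm x)\<^sup>2"
        unfolding q2[symmetric] using q0 by (simp add: sq)
      also have "\<dots> \<longleftrightarrow> y < (norm x)\<^sup>2 \<and> r < norm x"
        using r by (simp add: sq)
      finally show ?thesis .
    qed
    have "emeasure M1 {y<..} = emeasure (density lborel (\<lambda>x. ennreal (indicator A x))) {x. y < (norm x)\<^sup>2}"
      unfolding M1_def by (subst emeasure_distr) (auto intro!: arg_cong[where f = "emeasure _"])
    also have "\<dots> = (\<integral>\<^sup>+x. ennreal (indicator A x) * indicator {x. y < (norm x)\<^sup>2} x \<partial>lborel)"
      by (subst emeasure_density) auto
    also have "\<dots> = (\<integral>\<^sup>+x. indicator (ball (0::real^2) R - cball 0 q) x \<partial>lborel)"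
      by (intro nn_integral_cong) (use lt in \<open>auto simp: A_def indicator_def not_le\<close>)
    also have "\<dots> = emeasure lborel (ball (0::real^2) R - cball 0 q)"
      by (rule nn_integral_indicator) auto
    also have "\<dots> = ennreal (pi * max 0 (R\<^sup>2 - max y (r\<^sup>2)))"
    proof (cases "q < R")
      case True
      then have sub: "cball 0 q \<subseteq> ball (0::real^2) R" by auto
      have "emeasure lborel (ball (0::real^2) R - cball 0 q) = ennreal (pi * R\<^sup>2) - ennreal (pi * q\<^sup>2)"
        using r q0 sub by (subst emeasure_Diff) (auto simp: emeasure_lborel_cdisk emeasure_lborel_disk)
      also have "\<dots> = ennreal (pi * R\<^sup>2 - pi * q\<^sup>2)" by (rule ennreal_minus) simp
      also have "q\<^sup>2 < R\<^sup>2" using True q0 by (simp add: power_strict_mono)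
      then have "pi * R\<^sup>2 - pi * q\<^sup>2 = pi * max 0 (R\<^sup>2 - max y (r\<^sup>2))"
        unfolding q2 by (simp add: right_diff_distrib max_def)
      finally show ?thesis .
    next
      case False
      then have empty: "ball (0::real^2) R - cball 0 q = {}" by auto
      have "R\<^sup>2 \<le> q\<^sup>2" using False r by (intro power_mono) auto
      then show ?thesis unfolding q2 empty by simp
    qed
    finally show ?thesis .
  qed
  have M2: "emeasure M2 {y<..} = ennreal (pi * max 0 (R\<^sup>2 - max y (r\<^sup>2)))" for y
  proof -
    have "emeasure M2 {y<..} = (\<integral>\<^sup>+t. ennreal (pi * indicator {r\<^sup>2<..<R\<^sup>2} t) * indicator {y<..} t \<partial>lborel)"
      unfolding M2_def by (subst emeasure_density) auto
    also have "\<dots> = (\<integral>\<^sup>+t. ennreal pi * indicator {max y (r\<^sup>2)<..<R\<^sup>2} t \<partial>lborel)"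
      by (intro nn_integral_cong) (auto simp: indicator_def)
    also have "\<dots> = ennreal pi * emeasure lborel {max y (r\<^sup>2)<..<R\<^sup>2}"
      by (subst nn_integral_cmult_indicator) auto
    also have "emeasure lborel {max y (r\<^sup>2)<..<R\<^sup>2} = ennreal (max 0 (R\<^sup>2 - max y (r\<^sup>2)))"
    proof (cases "max y (r\<^sup>2) \<le> R\<^sup>2")
      case True
      then show ?thesis by (subst emeasure_lborel_Ioo) (auto simp: max_def)
    next
      case False
      then have "{max y (r\<^sup>2)<..<R\<^sup>2} = {}" by auto
      then show ?thesis using False by (simp add: max_def)
    qed
    also have "ennreal pi * \<dots> = ennreal (pi * max 0 (R\<^sup>2 - max y (r\<^sup>2)))"
      by (rule ennreal_mult[symmetric]) auto
    finally show ?thesis .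
  qed
  have eq: "M1 = M2"
  proof (rule measure_eqI_lessThan)
    show "emeasure M1 {y<..} < \<infinity>" for y unfolding M1 by simp
  qed (auto simp: M1 M2, auto simp: M1_def M2_def)
  have "(\<integral>x. indicator A x * f ((norm x)\<^sup>2) \<partial>lborel) = (\<integral>t. f t \<partial>M1)"
    unfolding M1_def by (simp add: integral_distr integral_density)
  also have "\<dots> = (\<integral>t. pi * (indicator {r\<^sup>2<..<R\<^sup>2} t * f t) \<partial>lborel)"
    unfolding eq M2_def by (simp add: integral_density mult.assoc)
  finally show ?thesis by (simp add: A_def)
qed

text \<open>Continuity is read off from the parameter integral rather than from the closed forms:
  the integrand is jointly continuous, also where the gain vanishes and \<open>F_y\<close> would be
  evaluated at 0.\<close>

lemma continuous_on_W:
  assumes r: "0 < r" "r < RL" and \<alpha>: "\<alpha> \<ge> 2" and s: "s > 0" and K: "K \<ge> 1" and n: "n \<ge> 1" and N: "N \<ge> 1"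
  shows "continuous_on UNIV (\<lambda>w. W N K r RL \<alpha> n w s)"
proof -
  let ?\<phi> = "\<lambda>w t. inverse ((1 + real n * s * array_gain N w / real K * t powr (- \<alpha> / 2)) ^ K)"
  have "continuous_on (UNIV \<times> cbox (r\<^sup>2) (RL\<^sup>2)) (\<lambda>(w, t). ?\<phi> w t)"
  proof -
    have 1: "continuous_on (UNIV \<times> cbox (r\<^sup>2) (RL\<^sup>2)) (\<lambda>p. array_gain N (fst p))"
      by (rule continuous_on_compose2[OF continuous_on_array_gain[OF N, of UNIV]]) (auto intro!: continuous_on_fst)
    have pos: "0 < snd p" if "p \<in> UNIV \<times> cbox (r\<^sup>2) (RL\<^sup>2)" for p :: "real \<times> real"
      using that r(1) by (auto intro: less_le_trans[of 0 "r\<^sup>2"])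
    then have 2: "continuous_on (UNIV \<times> cbox (r\<^sup>2) (RL\<^sup>2)) (\<lambda>p :: real \<times> real. snd p powr (- \<alpha> / 2))"
      by (intro continuous_on_powr continuous_on_snd continuous_on_id continuous_on_const) force
    have 3: "1 + real n * s * array_gain N w / real K * t powr (- \<alpha> / 2) > 0" for w t
      using s by (intro add_pos_nonneg mult_nonneg_nonneg divide_nonneg_nonneg array_gain_nonneg) auto
    have "continuous_on (UNIV \<times> cbox (r\<^sup>2) (RL\<^sup>2)) (\<lambda>p. ?\<phi> (fst p) (snd p))"
      using power_not_zero[OF less_imp_neq[OF 3, symmetric]] K
      by (intro continuous_on_inverse continuous_on_power continuous_on_add continuous_on_mult
          continuous_on_divide continuous_on_const 1 2) auto
    then show ?thesis by (simp add: case_prod_beta')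
  qed
  then have "continuous_on UNIV (\<lambda>w. - integral (cbox (r\<^sup>2) (RL\<^sup>2)) (?\<phi> w))"
    by (intro continuous_on_minus integral_continuous_on_param)
  moreover have "integral (cbox (r\<^sup>2) (RL\<^sup>2)) (?\<phi> w) = - W N K r RL \<alpha> n w s" for w
    using integral_unique[OF W_eq_integral[OF r \<alpha> s K n]] by simp
  ultimately show ?thesis by (simp only: minus_minus)
qed

lemma integral_lborel_eq_W:
  assumes r: "0 < r" "r < RL" and \<alpha>: "\<alpha> \<ge> 2" and s: "s > 0" and K: "K \<ge> 1" and n: "n \<ge> 1"
  shows "(\<integral>t. indicator {r\<^sup>2<..<RL\<^sup>2} t * inverse ((1 + real n * s * array_gain N w / real K * t powr (- \<alpha> / 2)) ^ K) \<partial>lborel)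
    = - W N K r RL \<alpha> n w s"
proof -
  let ?\<phi> = "\<lambda>t. inverse ((1 + real n * s * array_gain N w / real K * t powr (- \<alpha> / 2)) ^ K)"
  have pos: "0 < t" if "t \<in> {r\<^sup>2..RL\<^sup>2}" for t
    using that r(1) by (auto intro: less_le_trans[of 0 "r\<^sup>2"])
  have 3: "1 + real n * s * array_gain N w / real K * t powr (- \<alpha> / 2) > 0" for t
    using s by (intro add_pos_nonneg mult_nonneg_nonneg divide_nonneg_nonneg array_gain_nonneg) auto
  have "continuous_on {r\<^sup>2..RL\<^sup>2} (\<lambda>t. t powr (- \<alpha> / 2))"
    using pos by (intro continuous_on_powr continuous_on_id continuous_on_const) force
  then have cont: "continuous_on {r\<^sup>2..RL\<^sup>2} ?\<phi>"
    using power_not_zero[OF less_imp_neq[OF 3, symmetric]]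
    by (intro continuous_on_inverse continuous_on_power continuous_on_add continuous_on_mult
        continuous_on_const) auto
  have "(\<integral>t. indicator {r\<^sup>2<..<RL\<^sup>2} t * ?\<phi> t \<partial>lborel) = (\<integral>t. indicator {r\<^sup>2..RL\<^sup>2} t *\<^sub>R ?\<phi> t \<partial>lborel)"
  proof (rule integral_cong_AE)
    show "AE t in lborel. indicator {r\<^sup>2<..<RL\<^sup>2} t * ?\<phi> t = indicator {r\<^sup>2..RL\<^sup>2} t *\<^sub>R ?\<phi> t"
      using AE_lborel_singleton[of "r\<^sup>2"] AE_lborel_singleton[of "RL\<^sup>2"]
      by eventually_elim (auto simp: indicator_def)
  qed measurable
  also have "\<dots> = integral {r\<^sup>2..RL\<^sup>2} ?\<phi>"
    using borel_integrable_atLeastAtMost'[OF cont]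
    by (intro set_borel_integral_eq_integral(2)[unfolded set_lebesgue_integral_def])
  also have "\<dots> = - W N K r RL \<alpha> n w s"
    by (rule integral_unique[OF W_eq_integral[OF r \<alpha> s K n]])
  finally show ?thesis .
qed

lemma laplace_interference_eq:
  fixes M :: "'w measure" and \<Phi> :: "'w \<Rightarrow> (real^2) set" and \<omega> h :: "'w \<Rightarrow> real^2 \<Rightarrow> real"
  assumes M: "prob_space M"
    and lam2: "lam2 > 0" and r: "0 < r" "r < RL" and d: "d > 0" "lam > 0" and \<alpha>: "\<alpha> \<ge> 2" and s: "s > 0"
    and N: "N \<ge> 1" and K: "K \<ge> 1" and n: "n \<ge> 1"
    and ppp: "homogeneous_ppp M lam2 {x. norm x > r} \<Phi>"
    and marked: "independently_marked M (angle_law d lam \<Otimes>\<^sub>M fading_law K) \<Phi> (\<lambda>z x. (\<omega> z x, h z x))"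
  shows "laplace_interference M \<Phi> \<omega> h N RL \<alpha> n s
    = exp (- (lam2 * (pi * ((RL\<^sup>2 - r\<^sup>2) + integral {-1..1} (\<lambda>x. W N K r RL \<alpha> n (x * d / lam) s) / 2))))"
proof -
  interpret prob_space M by fact
  define U where "U = angle_law d lam"
  define G where "G = fading_law K"
  interpret U: prob_space U unfolding U_def by (rule prob_space_angle_law[OF d])
  interpret G: prob_space G unfolding G_def by (rule prob_space_fading_law[OF K])
  interpret UG: pair_prob_space U G ..
  interpret UL: pair_sigma_finite U "lborel :: real measure" ..
  have [measurable_cong]: "sets U = sets borel" "sets G = sets borel"
    by (simp_all add: U_def G_def sets_angle_law sets_fading_law)
  have [measurable]: "array_gain N \<in> borel_measurable borel"
    by (rule borel_measurable_continuous_onI[OF continuous_on_array_gain[OF N]])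
  define B where "B = {x :: real^2. r < norm x \<and> norm x < RL}"
  have B[measurable]: "B \<in> sets borel" unfolding B_def by measurable
  have bB: "bounded B" by (rule bounded_subset[OF bounded_ball[of 0 RL]]) (auto simp: B_def)
  have BA: "B \<subseteq> {x. norm x > r}" by (auto simp: B_def)
  have fin: "finite (\<Phi> z \<inter> B)" if "z \<in> space M" for z
    using that bB by (rule homogeneous_ppp_finite[OF ppp])
  \<comment> \<open>All interferers lie outside the inner radius, so those within line of sight are
    exactly the points in the bounded annulus B.\<close>
  have sub: "{x \<in> \<Phi> z. norm x < RL} = \<Phi> z \<inter> B" if "z \<in> space M" for z
    using homogeneous_ppp_subset[OF ppp that] by (auto simp: B_def)
  define e where "e = (\<lambda>(x :: real^2) m. exp (- (real n * s * array_gain N (fst m) * norm x powr (- \<alpha>) * snd m)))"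
  have e[measurable]: "(\<lambda>p. e (fst p) (snd p)) \<in> borel_measurable (borel \<Otimes>\<^sub>M (U \<Otimes>\<^sub>M G))"
    unfolding e_def by measurable
  have e0: "0 \<le> e x m" for x m by (simp add: e_def)
  have e1: "AE m in U \<Otimes>\<^sub>M G. \<forall>x. e x m \<le> 1"
  proof -
    have "AE m in U \<Otimes>\<^sub>M G. 0 \<le> snd m"
    proof (rule UG.AE_pair_measure)
      show "AE w in U. AE h in G. 0 \<le> snd (w, h)"
        unfolding snd_conv G_def by (rule AE_I2) (rule AE_fading_law_nonneg[OF K])
    qed measurable
    then show ?thesis
      by eventually_elim (use s in \<open>auto simp: e_def intro!: mult_nonneg_nonneg array_gain_nonneg\<close>)
  qed
  define \<phi> where "\<phi> = (\<lambda>w t. inverse ((1 + real n * s * array_gain N w / real K * t powr (- \<alpha> / 2)) ^ K))"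
  have \<phi>[measurable]: "(\<lambda>p. \<phi> (fst p) (snd p)) \<in> borel_measurable (borel \<Otimes>\<^sub>M borel)"
    unfolding \<phi>_def by measurable
  have ge1: "1 + real n * s * array_gain N w / real K * t powr (- \<alpha> / 2) \<ge> 1" for w t
    using s by (intro add_increasing2 mult_nonneg_nonneg divide_nonneg_nonneg array_gain_nonneg) auto
  have \<phi>0: "0 \<le> \<phi> w t" and \<phi>1: "\<phi> w t \<le> 1" for w t
  proof -
    have "1 \<le> (1 + real n * s * array_gain N w / real K * t powr (- \<alpha> / 2)) ^ K"
      using ge1 by (rule one_le_power)
    then show "0 \<le> \<phi> w t" "\<phi> w t \<le> 1" by (auto simp: \<phi>_def intro!: inverse_le_1_iff[THEN iffD2])
  qed
  define \<gamma> where "\<gamma> = (\<lambda>t. \<integral>w. \<phi> w t \<partial>U)"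
  have \<gamma>[measurable]: "\<gamma> \<in> borel_measurable borel"
    unfolding \<gamma>_def
    by (rule U.borel_measurable_lebesgue_integral)
       (use measurable_compose[OF measurable_Pair[OF measurable_snd measurable_fst] \<phi>] in \<open>simp add: case_prod_beta'\<close>)
  have \<gamma>0: "0 \<le> \<gamma> t" for t unfolding \<gamma>_def by (rule Bochner_Integration.integral_nonneg) (rule \<phi>0)
  have \<phi>U: "\<phi> w \<in> borel_measurable borel" "(\<lambda>w. \<phi> w t) \<in> borel_measurable U" for w t
    unfolding \<phi>_def by measurable
  have int\<phi>: "integrable U (\<lambda>w. \<phi> w t)" for t
    using \<phi>0 \<phi>1 \<phi>U(2) by (intro U.integrable_const_bound[where B = 1]) auto
  have \<gamma>1: "\<gamma> t \<le> 1" for t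
    unfolding \<gamma>_def using \<phi>1 by (intro U.integral_le_const int\<phi>) auto
  have mark: "(\<integral>m. e x m \<partial>(U \<Otimes>\<^sub>M G)) = \<gamma> ((norm x)\<^sup>2)" for x
  proof -
    have "integrable (U \<Otimes>\<^sub>M G) (e x)"
    proof (rule UG.integrable_const_bound[where B = 1])
      show "AE m in U \<Otimes>\<^sub>M G. norm (e x m) \<le> 1"
        using e1 by eventually_elim (simp add: e0)
      show "e x \<in> borel_measurable (U \<Otimes>\<^sub>M G)" unfolding e_def by measurable
    qed
    from UG.integral_fst'[OF this]
    have "(\<integral>m. e x m \<partial>(U \<Otimes>\<^sub>M G)) = (\<integral>w. \<integral>h. e x (w, h) \<partial>G \<partial>U)" by simp
    also have "\<dots> = \<gamma> ((norm x)\<^sup>2)"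
      unfolding \<gamma>_def
    proof (rule Bochner_Integration.integral_cong[OF refl])
      fix w
      have "(norm x)\<^sup>2 powr (- \<alpha> / 2) = norm x powr (- \<alpha>)"
      proof (cases "x = 0")
        case False
        then have "(norm x)\<^sup>2 = norm x powr 2" by (simp add: powr_numeral)
        then show ?thesis by (simp only: powr_powr) simp
      qed simp
      moreover have "(\<integral>h. e x (w, h) \<partial>G)
          = inverse ((1 + real n * s * array_gain N w * norm x powr (- \<alpha>) / real K) ^ K)"
        unfolding e_def G_def fst_conv snd_conv using s
        by (intro fading_law_laplace K mult_nonneg_nonneg array_gain_nonneg) auto
      ultimately show "(\<integral>h. e x (w, h) \<partial>G) = \<phi> w ((norm x)\<^sup>2)"
        by (simp add: \<phi>_def)
    qed
    finally show ?thesis .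
  qed
  have "laplace_interference M \<Phi> \<omega> h N RL \<alpha> n s = expectation (\<lambda>z. \<Prod>x\<in>\<Phi> z \<inter> B. e x (\<omega> z x, h z x))"
    unfolding laplace_interference_def
  proof (rule Bochner_Integration.integral_cong[OF refl])
    fix z assume z: "z \<in> space M"
    show "exp (- (real n * s * (\<Sum>x\<in>{x \<in> \<Phi> z. norm x < RL}. array_gain N (\<omega> z x) * h z x * norm x powr - \<alpha>)))
        = (\<Prod>x\<in>\<Phi> z \<inter> B. e x (\<omega> z x, h z x))"
      unfolding sub[OF z] e_def exp_sum[OF fin[OF z], symmetric]
      by (simp add: sum_distrib_left sum_negf mult_ac)
  qed
  also have "\<dots> = expectation (\<lambda>z. \<Prod>x\<in>\<Phi> z \<inter> B. \<gamma> ((norm x)\<^sup>2))"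
    unfolding mark[symmetric]
    using marked by (intro expectation_prod_marks UG.prob_space_axioms fin B e e0 e1) (simp add: U_def G_def)
  also have "\<dots> = exp (- (lam2 * (\<integral>x. indicator B x * (1 - \<gamma> ((norm x)\<^sup>2)) \<partial>lborel)))"
    using lam2 by (intro homogeneous_ppp_expectation_prod[OF ppp _ B bB BA] \<gamma>0 \<gamma>1) auto
  also have "(\<integral>x. indicator B x * (1 - \<gamma> ((norm x)\<^sup>2)) \<partial>lborel) = pi * (\<integral>t. indicator {r\<^sup>2<..<RL\<^sup>2} t * (1 - \<gamma> t) \<partial>lborel)"
    unfolding B_def by (rule annulus_integral[OF r]) measurable
  also have "(\<integral>t. indicator {r\<^sup>2<..<RL\<^sup>2} t * (1 - \<gamma> t) \<partial>lborel)
      = (RL\<^sup>2 - r\<^sup>2) + integral {-1..1} (\<lambda>x. W N K r RL \<alpha> n (x * d / lam) s) / 2"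
  proof -
    let ?J = "{r\<^sup>2<..<RL\<^sup>2}"
    have le: "r\<^sup>2 \<le> RL\<^sup>2" using r by (intro power_mono) auto
    have intJ: "integrable lborel (indicator ?J :: real \<Rightarrow> real)"
      using le by (intro integrable_real_indicator) auto
    have int\<gamma>: "integrable lborel (\<lambda>t. indicator ?J t * \<gamma> t)"
      by (rule Bochner_Integration.integrable_bound[OF intJ])
        (use \<gamma>0 \<gamma>1 in \<open>auto simp: indicator_def\<close>)
    have "(\<integral>t. indicator ?J t * (1 - \<gamma> t) \<partial>lborel) = (\<integral>t. indicator ?J t - indicator ?J t * \<gamma> t \<partial>lborel)"
      by (simp add: right_diff_distrib)
    also have "\<dots> = (RL\<^sup>2 - r\<^sup>2) - (\<integral>t. indicator ?J t * \<gamma> t \<partial>lborel)"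
      using le by (subst Bochner_Integration.integral_diff[OF intJ int\<gamma>]) simp
    also have "(\<integral>t. indicator ?J t * \<gamma> t \<partial>lborel) = (\<integral>t. \<integral>w. indicator ?J t * \<phi> w t \<partial>U \<partial>lborel)"
      by (simp add: \<gamma>_def)
    also have "\<dots> = (\<integral>w. \<integral>t. indicator ?J t * \<phi> w t \<partial>lborel \<partial>U)"
    \<comment> \<open>The integrand is dominated by the indicator of a rectangle of finite measure.
      After the swap, the inner integral over t is -\<open>W\<close>.\<close>
    proof (rule UL.Fubini_integral)
      have emea: "emeasure (U \<Otimes>\<^sub>M lborel) (space U \<times> ?J) < \<infinity>"
        using le by (subst lborel.emeasure_pair_measure_Times) (auto simp: U.emeasure_space_1)
      have "integrable (U \<Otimes>\<^sub>M lborel) (indicator (space U \<times> ?J) :: _ \<Rightarrow> real)"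
        using emea by (intro integrable_real_indicator) auto
      then show "integrable (U \<Otimes>\<^sub>M lborel) (\<lambda>(w, t). indicator ?J t * \<phi> w t)"
      proof (rule Bochner_Integration.integrable_bound)
        show "(\<lambda>(w, t). indicator ?J t * \<phi> w t) \<in> borel_measurable (U \<Otimes>\<^sub>M lborel)"
          unfolding \<phi>_def by measurable
        show "AE p in U \<Otimes>\<^sub>M lborel. norm ((\<lambda>(w, t). indicator ?J t * \<phi> w t) p) \<le> norm (indicator (space U \<times> ?J) p :: real)"
          using \<phi>0 \<phi>1 by (intro AE_I2) (auto simp: indicator_def space_pair_measure)
      qed
    qed
    also have "\<dots> = (\<integral>w. - W N K r RL \<alpha> n w s \<partial>U)"
      unfolding \<phi>_def integral_lborel_eq_W[OF r \<alpha> s K n] ..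
    also have "\<dots> = - (integral {-1..1} (\<lambda>x. W N K r RL \<alpha> n (x * d / lam) s) / 2)"
      unfolding U_def using angle_law_integral[OF d continuous_on_W[OF r \<alpha> s K n N]] by simp
    finally show ?thesis by simp
  qed
  finally show ?thesis .
qed

theorem lemma2:
  fixes M :: "'w measure"
    and \<Phi> :: "'w \<Rightarrow> (real^2) set"
    and \<omega> h :: "'w \<Rightarrow> real^2 \<Rightarrow> real"
    and lam2 r RL d lam \<alpha>\<^sub>2 s :: real
    and N K n :: nat
  assumes "prob_space M"
    and "lam2 > 0" and "0 < r" and "r < RL" and "d > 0" and "lam > 0" and "\<alpha>\<^sub>2 \<ge> 2" and "s > 0"
    and "N \<ge> 1" and "K \<ge> 1" and "n \<ge> 1"
    and "homogeneous_ppp M lam2 {x. norm x > r} \<Phi>"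
    and "independently_marked M (angle_law d lam \<Otimes>\<^sub>M fading_law K) \<Phi> (\<lambda>z x. (\<omega> z x, h z x))"
  shows "(\<lambda>u. exp (- pi * lam2 * (RL\<^sup>2 - r\<^sup>2)
                   - pi\<^sup>2 * lam2 / (2 * real u) *
                     (\<Sum>k = 1..u. W N K r RL \<alpha>\<^sub>2 n (cheb_node u k * d / lam) s
                                  * sqrt (1 - (cheb_node u k)\<^sup>2))))
         \<longlonglongrightarrow> laplace_interference M \<Phi> \<omega> h N RL \<alpha>\<^sub>2 n s"
proof -
  define f where "f = (\<lambda>x. W N K r RL \<alpha>\<^sub>2 n (x * d / lam) s)"
  have "continuous_on {-1..1} f"
    unfolding f_def using assms(5,6)
    by (intro continuous_on_compose2[OF continuous_on_W[OF assms(3,4,7,8,10,11,9)]] continuous_intros) auto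
  then have lim: "(\<lambda>u. pi / real u * (\<Sum>k=1..u. f (cheb_node u k) * sqrt (1 - (cheb_node u k)\<^sup>2)))
     \<longlonglongrightarrow> integral {-1..1} f"
    by (rule gauss_chebyshev)
  \<comment> \<open>The constant in front of the sum is regrouped: one \<pi> is the area factor of
    the plane, the other belongs to the quadrature weight \<pi>/u, and 1/2 comes from the uniform
    angle.\<close>
  have "(\<lambda>u. exp (- pi * lam2 * (RL\<^sup>2 - r\<^sup>2) - pi * lam2 / 2 *
          (pi / real u * (\<Sum>k=1..u. f (cheb_node u k) * sqrt (1 - (cheb_node u k)\<^sup>2)))))
     \<longlonglongrightarrow> exp (- pi * lam2 * (RL\<^sup>2 - r\<^sup>2) - pi * lam2 / 2 * integral {-1..1} f)"
    by (intro tendsto_intros lim)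
  also have "exp (- pi * lam2 * (RL\<^sup>2 - r\<^sup>2) - pi * lam2 / 2 * integral {-1..1} f)
      = laplace_interference M \<Phi> \<omega> h N RL \<alpha>\<^sub>2 n s"
    unfolding laplace_interference_eq[OF assms] f_def by (simp add: algebra_simps)
  finally show ?thesis
    by (simp add: f_def power2_eq_square mult_ac)
qed

end
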